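(* There exist two dynamical simplices $K,L$ of a Cantor space $X$, and homeomorphisms $g,h$ of $X$ such that $g_*K\subset L$ and $h_*L\subset K$, yet there is no homeomorphism $f$ of $X$ such that $f_*K=L$.
   Context: A homeomorphism of a Cantor space $X$ is minimal if all its orbits are dense. A set $K$ of Borel probability measures on $X$ is a dynamical simplex if there exists a minimal homeomorphism $\varphi$ of $X$ such that $K$ is exactly the set of $\varphi$-invariant Borel probability measures on $X$. For a homeomorphism $g$ of $X$ and a Borel probability measure $\mu$ on $X$, $g_*\mu(A)=\mu(g^{-1}(A))$, and $g_*K=\{g_*\mu:\mu\in K\}$. The inclusion symbol $\subset$ is not necessarily strict. *)

theory Defs
  imports "HOL-Probability.Probability"
begin

definition cantor_space :: "'a topology \<Rightarrow> bool" where
  "cantor_space X \<longleftrightarrow>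
     X homeomorphic_space
       product_topology (\<lambda>_::nat. discrete_topology (UNIV :: bool set)) UNIV"

definition borel_of_top :: "'a topology \<Rightarrow> 'a measure" where
  "borel_of_top X = sigma (topspace X) {U. openin X U}"

definition borel_prob_measures :: "'a topology \<Rightarrow> 'a measure set" where
  "borel_prob_measures X = {\<mu>. prob_space \<mu> \<and> sets \<mu> = sets (borel_of_top X)}"

(* For a self-homeomorphism g of X this is g_* mu:
   emeasure (pushforward X g mu) A = emeasure mu (g -` A \<inter> topspace X) for Borel A. *)
definition pushforward :: "'a topology \<Rightarrow> ('a \<Rightarrow> 'a) \<Rightarrow> 'a measure \<Rightarrow> 'a measure" where
  "pushforward X g \<mu> = distr \<mu> (borel_of_top X) g"

(* The full (two-sided) orbit; the second disjunct gives the negative iterates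
   when \<phi> is a bijection of topspace X. *)
definition two_sided_orbit :: "'a topology \<Rightarrow> ('a \<Rightarrow> 'a) \<Rightarrow> 'a \<Rightarrow> 'a set" where
  "two_sided_orbit X \<phi> x =
     {y \<in> topspace X. \<exists>n. y = (\<phi> ^^ n) x \<or> (\<phi> ^^ n) y = x}"

definition minimal_homeomorphism :: "'a topology \<Rightarrow> ('a \<Rightarrow> 'a) \<Rightarrow> bool" where
  "minimal_homeomorphism X \<phi> \<longleftrightarrow>
     homeomorphic_map X X \<phi> \<and>
     (\<forall>x\<in>topspace X. X closure_of two_sided_orbit X \<phi> x = topspace X)"

definition invariant_measures :: "'a topology \<Rightarrow> ('a \<Rightarrow> 'a) \<Rightarrow> 'a measure set" where
  "invariant_measures X \<phi> = {\<mu> \<in> borel_prob_measures X. pushforward X \<phi> \<mu> = \<mu>}"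

definition dynamical_simplex :: "'a topology \<Rightarrow> 'a measure set \<Rightarrow> bool" where
  "dynamical_simplex X K \<longleftrightarrow>
     (\<exists>\<phi>. minimal_homeomorphism X \<phi> \<and> K = invariant_measures X \<phi>)"

end

(*
  The clopen sets of the two Cantor systems carry a "value function": to a clopen set A it assigns a
  rational-valued function val A on a countable dense set of parameters, continuous on the closure Y of
  that set in the 2-adic integers.  A Borel probability measure is invariant iff it gives equal mass to
  clopen sets with equal value functions; the ergodic measures are the evaluations of val at the points
  of Y.  Moreover every continuous rational-valued f with 0 < f < val A is the value function of a
  clopen subset of A.  By back and forth this homogeneity makes the system determined by Y, and turns a
  closed embedding of parameter spaces into a homeomorphism mapping one simplex into the other.  We take
  Y to be the Cantor set (all 2-adic integers), and the Cantor set with an isolated point (0 and the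
  odd 2-adic integers).  Each embeds in the other.  But only for the second one can a measure in the
  simplex be the strict maximiser of the mass of some clopen set: a locally constant function on a space
  without isolated points never attains its maximum exactly once.

  Each system is an odometer with finitely many towers of equal height at every level.  The towers of
  level n + 1 are cut and stacked from those of level n: most of tower w is made of copies of the tower
  labelled by the reduction of w, but all towers of level n also occur, which gives minimality.
*)
theory Submission
  imports Defs
begin

text \<open>The obstacle is to embed each simplex in the other by a map of the space: an affine
  embedding is not enough, the masses of clopen sets must match as well. So both systems have to
  admit the same values. Only rational ones occur, because a tower has finitely many floors, and to
  realise all of them the tower heights must eventually be divisible by every integer. The squares
  in \<open>width\<close> provide this. They also fix the proportion of a word spent on listing all
  towers to \<open>1 / (n + 2)^2\<close>: every tower is listed, so that orbits are dense, but these
  proportions are summable, so that densities in differently labelled towers stay apart in the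
  limit. With a divergent sum only one invariant measure would remain. The listing stands at both
  ends of every word, so the passage from the top of one tower to the bottom of the next looks the
  same whichever towers are involved; this makes the shift continuous. The 2-adic integers are not
  constructed: a function on the parameter space is a function of natural numbers invariant under
  the retraction \<open>q\<close>, and local constancy is dependence on \<open>k mod 2 ^ n\<close>
  for some \<open>n\<close>.\<close>

section \<open>Clopen sets and Stone spaces\<close>

definition clopens :: "'a topology \<Rightarrow> 'a set set" where
  "clopens X = {A. openin X A \<and> closedin X A}"

lemma clopens_subset: "A \<in> clopens X \<Longrightarrow> A \<subseteq> topspace X"
  by (auto simp: clopens_def dest: openin_subset)

lemma clopens_empty [simp]: "{} \<in> clopens X"
  and clopens_topspace [simp]: "topspace X \<in> clopens X"
  by (auto simp: clopens_def)

lemma clopens_Int: "A \<in> clopens X \<Longrightarrow> B \<in> clopens X \<Longrightarrow> A \<inter> B \<in> clopens X"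
  and clopens_Un: "A \<in> clopens X \<Longrightarrow> B \<in> clopens X \<Longrightarrow> A \<union> B \<in> clopens X"
  and clopens_Diff: "A \<in> clopens X \<Longrightarrow> B \<in> clopens X \<Longrightarrow> A - B \<in> clopens X"
  by (auto simp: clopens_def)

lemma clopens_Union: "finite F \<Longrightarrow> F \<subseteq> clopens X \<Longrightarrow> \<Union>F \<in> clopens X"
  by (induction F rule: finite_induct) (auto intro: clopens_Un)

lemma clopens_vimage:
  assumes "continuous_map X Y f" "B \<in> clopens Y"
  shows "{x \<in> topspace X. f x \<in> B} \<in> clopens X"
  using assms by (simp add: clopens_def openin_continuous_map_preimage closedin_continuous_map_preimage)

text \<open>The countable base is part of the notion: it makes the clopen algebra countable, which
  is used to enumerate clopen sets in the back and forth and to generate the Borel sets from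
  them.\<close>

definition stone_space :: "'a topology \<Rightarrow> bool" where
  "stone_space X \<longleftrightarrow> compact_space X \<and> Hausdorff_space X \<and>
     (\<exists>\<B>. countable \<B> \<and> \<B> \<subseteq> clopens X \<and>
        (\<forall>U x. openin X U \<and> x \<in> U \<longrightarrow> (\<exists>V\<in>\<B>. x \<in> V \<and> V \<subseteq> U)))"

lemma stone_space_clopen_nbhd:
  assumes "stone_space X" "openin X U" "x \<in> U"
  obtains V where "V \<in> clopens X" "x \<in> V" "V \<subseteq> U"
  using assms unfolding stone_space_def by (meson subsetD)

lemma stone_space_separate:
  assumes "stone_space X" "x \<in> topspace X" "y \<in> topspace X" "x \<noteq> y"
  obtains V where "V \<in> clopens X" "x \<in> V" "y \<notin> V"
proof -
  have "Hausdorff_space X" using assms by (simp add: stone_space_def)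
  then obtain U W where "openin X U" "openin X W" "x \<in> U" "y \<in> W" "disjnt U W"
    using assms unfolding Hausdorff_space_def by blast
  moreover obtain V where "V \<in> clopens X" "x \<in> V" "V \<subseteq> U"
    using stone_space_clopen_nbhd[OF assms(1) \<open>openin X U\<close> \<open>x \<in> U\<close>] .
  ultimately show ?thesis
    using that by (metis disjnt_iff subsetD)
qed

lemma stone_space_compactin:
  assumes "stone_space X" "A \<in> clopens X"
  shows "compactin X A"
  using assms closedin_compact_space by (auto simp: stone_space_def clopens_def)

lemma stone_space_nested:
  assumes "stone_space X" "\<And>n. C n \<in> clopens X" "\<And>n. C n \<noteq> {}" "decseq C"
  shows "(\<Inter>n. C n) \<noteq> {}"
  using assms by (intro compact_space_imp_nest[of X]) (auto simp: stone_space_def clopens_def)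

text \<open>A clopen set is compact, hence a finite union of members of the countable base.\<close>

lemma countable_clopens:
  assumes "stone_space X"
  shows "countable (clopens X)"
proof -
  obtain \<B> where B: "countable \<B>" "\<B> \<subseteq> clopens X"
    "\<And>U x. openin X U \<Longrightarrow> x \<in> U \<Longrightarrow> \<exists>V\<in>\<B>. x \<in> V \<and> V \<subseteq> U"
    using assms unfolding stone_space_def by metis
  have "clopens X \<subseteq> Union ` {F. finite F \<and> F \<subseteq> \<B>}"
  proof
    fix A assume A: "A \<in> clopens X"
    let ?U = "{V\<in>\<B>. V \<subseteq> A}"
    have "A \<subseteq> \<Union>?U"
      using A B(3)[of A] by (fastforce simp: clopens_def)
    moreover have "Ball ?U (openin X)"
      using B by (auto simp: clopens_def)
    ultimately have "\<exists>F. finite F \<and> F \<subseteq> ?U \<and> A \<subseteq> \<Union>F"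
      using stone_space_compactin[OF assms A] unfolding compactin_def by blast
    then obtain F where F: "finite F" "F \<subseteq> ?U" "A \<subseteq> \<Union>F"
      by (elim exE conjE)
    then have "A = \<Union>F" by blast
    with F show "A \<in> Union ` {F. finite F \<and> F \<subseteq> \<B>}" by auto
  qed
  then show ?thesis
    by (rule countable_subset[OF _ countable_image[OF countable_Collect_finite_subset[OF B(1)]]])
qed

lemma stone_space_openin_Union:
  assumes "stone_space X" "openin X U"
  shows "U = \<Union>{A \<in> clopens X. A \<subseteq> U}"
proof -
  have "\<exists>V\<in>clopens X. x \<in> V \<and> V \<subseteq> U" if "x \<in> U" for x
    using stone_space_clopen_nbhd[OF assms that] by metis
  then show ?thesis by blast
qed

section \<open>Borel measures on Stone spaces\<close>

lemma openin_subset_Pow: "{U. openin X U} \<subseteq> Pow (topspace X)"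
  using openin_subset by auto

lemma space_borel_of_top [simp]: "space (borel_of_top X) = topspace X"
  unfolding borel_of_top_def using openin_subset_Pow by (rule space_measure_of)

lemma sets_borel_of_top: "sets (borel_of_top X) = sigma_sets (topspace X) {U. openin X U}"
  unfolding borel_of_top_def using openin_subset_Pow by (rule sets_measure_of)

lemma clopens_in_borel: "A \<in> clopens X \<Longrightarrow> A \<in> sets (borel_of_top X)"
  by (auto simp: sets_borel_of_top clopens_def)

lemma sets_borel_clopens:
  assumes "stone_space X"
  shows "sets (borel_of_top X) = sigma_sets (topspace X) (clopens X)"
  unfolding sets_borel_of_top
proof (rule sigma_sets_eqI)
  fix U assume "U \<in> {U. openin X U}"
  then have U: "openin X U" by simp
  have "countable {A \<in> clopens X. A \<subseteq> U}"
    using countable_clopens[OF assms] by simp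
  then have "\<Union>{A \<in> clopens X. A \<subseteq> U} \<in> sigma_sets (topspace X) (clopens X)"
    by (rule sigma_sets_UNION) auto
  then show "U \<in> sigma_sets (topspace X) (clopens X)"
    using stone_space_openin_Union[OF assms U] by simp
qed (auto simp: clopens_def)

lemma borel_prob_measuresD:
  assumes "\<mu> \<in> borel_prob_measures X"
  shows "prob_space \<mu>" "sets \<mu> = sets (borel_of_top X)" "space \<mu> = topspace X"
proof -
  show "prob_space \<mu>" and s: "sets \<mu> = sets (borel_of_top X)"
    using assms by (auto simp: borel_prob_measures_def)
  show "space \<mu> = topspace X"
    using sets_eq_imp_space_eq[OF s] by simp
qed

lemma borel_measure_eqI:
  assumes "stone_space X" "\<mu> \<in> borel_prob_measures X" "\<nu> \<in> borel_prob_measures X"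
    and eq: "\<And>A. A \<in> clopens X \<Longrightarrow> measure \<mu> A = measure \<nu> A"
  shows "\<mu> = \<nu>"
proof (rule measure_eqI_generator_eq)
  interpret m: prob_space \<mu> using assms borel_prob_measuresD by blast
  interpret n: prob_space \<nu> using assms borel_prob_measuresD by blast
  show "Int_stable (clopens X)"
    by (auto simp: Int_stable_def clopens_Int)
  show "clopens X \<subseteq> Pow (topspace X)"
    using clopens_subset by blast
  show "emeasure \<mu> A = emeasure \<nu> A" if "A \<in> clopens X" for A
    using eq[OF that] by (simp add: m.emeasure_eq_measure n.emeasure_eq_measure)
  show "sets \<mu> = sigma_sets (topspace X) (clopens X)" "sets \<nu> = sigma_sets (topspace X) (clopens X)"
    using assms borel_prob_measuresD(2) sets_borel_clopens by metis+
  show "range (\<lambda>i::nat. topspace X) \<subseteq> clopens X" "(\<Union>i::nat. topspace X) = topspace X"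
    "emeasure \<mu> (topspace X) \<noteq> \<infinity>"
    by auto
qed

text \<open>Finite additivity suffices: by compactness a decreasing sequence of clopen sets with
  empty intersection is eventually empty, so continuity at the empty set is automatic and
  Caratheodory applies.\<close>

lemma borel_measure_extension:
  assumes X: "stone_space X"
    and nonneg: "\<And>A. A \<in> clopens X \<Longrightarrow> 0 \<le> f A"
    and one: "f (topspace X) = (1::real)"
    and add: "\<And>A B. A \<in> clopens X \<Longrightarrow> B \<in> clopens X \<Longrightarrow> A \<inter> B = {} \<Longrightarrow> f (A \<union> B) = f A + f B"
  obtains \<mu> where "\<mu> \<in> borel_prob_measures X" "\<And>A. A \<in> clopens X \<Longrightarrow> measure \<mu> A = f A"
proof -
  have "algebra (topspace X) (clopens X)"
    unfolding algebra_iff_Un by (auto simp: clopens_Un clopens_Diff dest: clopens_subset)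
  then interpret algebra "topspace X" "clopens X" .
  let ?f = "\<lambda>A. ennreal (f A)"
  have f0: "f {} = 0"
    using add[of "{}" "{}"] by simp
  have "\<exists>\<mu>. (\<forall>s\<in>clopens X. \<mu> s = ?f s) \<and> measure_space (topspace X) (sigma_sets (topspace X) (clopens X)) \<mu>"
  proof (rule caratheodory_empty_continuous)
    show "positive (clopens X) ?f"
      by (simp add: positive_def f0)
    show "additive (clopens X) ?f"
      by (auto simp: additive_def add nonneg ennreal_plus[symmetric] simp del: ennreal_plus)
    fix C :: "nat \<Rightarrow> 'a set"
    assume C: "range C \<subseteq> clopens X" "decseq C" "(\<Inter>i. C i) = {}"
    then obtain N where "C N = {}"
      using stone_space_nested[OF X, of C] by (metis range_subsetD)
    have "C n = {}" if "N \<le> n" for n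
      using C(2) that \<open>C N = {}\<close> unfolding decseq_def by blast
    then have "\<forall>\<^sub>F n in sequentially. ?f (C n) = 0"
      unfolding eventually_sequentially by (auto intro!: exI[of _ N] simp: f0)
    then show "(\<lambda>i. ?f (C i)) \<longlonglongrightarrow> 0"
      by (rule tendsto_eventually)
  qed auto
  then obtain m where m: "\<And>A. A \<in> clopens X \<Longrightarrow> m A = ?f A"
    "measure_space (topspace X) (sigma_sets (topspace X) (clopens X)) m" by blast
  define \<mu> where "\<mu> = measure_of (topspace X) (clopens X) m"
  have sp: "clopens X \<subseteq> Pow (topspace X)"
    using clopens_subset by blast
  have sets: "sets \<mu> = sigma_sets (topspace X) (clopens X)"
    unfolding \<mu>_def using sp by (rule sets_measure_of)
  have em: "emeasure \<mu> A = ?f A" if "A \<in> clopens X" for A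
  proof -
    have "emeasure \<mu> A = m A"
      using m(2) unfolding \<mu>_def
      by (intro emeasure_measure_of[OF refl sp])
         (use that in \<open>auto simp: measure_space_def sets[unfolded \<mu>_def]\<close>)
    then show ?thesis using m(1)[OF that] by simp
  qed
  have space: "space \<mu> = topspace X"
    unfolding \<mu>_def using sp by (rule space_measure_of)
  have "prob_space \<mu>"
    by (rule prob_spaceI) (simp add: space em one)
  then have "\<mu> \<in> borel_prob_measures X"
    unfolding borel_prob_measures_def using sets sets_borel_clopens[OF X] by simp
  then show ?thesis
    using that em nonneg by (simp add: measure_def)
qed

section \<open>Transport of measures along homeomorphisms\<close>

lemma measurable_borel_of_top:
  assumes "continuous_map X Y f" "\<mu> \<in> borel_prob_measures X"
  shows "f \<in> measurable \<mu> (borel_of_top Y)"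
proof -
  have "f \<in> measurable \<mu> (sigma (topspace Y) {U. openin Y U})"
  proof (rule measurable_sigma_sets[OF sets_measure_of[OF openin_subset_Pow] openin_subset_Pow])
    show "f \<in> space \<mu> \<rightarrow> topspace Y"
      using assms borel_prob_measuresD(3) by (fastforce simp: continuous_map_def)
    fix U assume "U \<in> {U. openin Y U}"
    then have "openin X {x \<in> topspace X. f x \<in> U}"
      using assms(1) by (simp add: openin_continuous_map_preimage)
    moreover have "f -` U \<inter> space \<mu> = {x \<in> topspace X. f x \<in> U}"
      using borel_prob_measuresD(3)[OF assms(2)] by auto
    ultimately show "f -` U \<inter> space \<mu> \<in> sets \<mu>"
      using borel_prob_measuresD(2)[OF assms(2)] by (auto simp: sets_borel_of_top)
  qed
  then show ?thesis by (simp add: borel_of_top_def)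
qed

text \<open>Unlike \<open>pushforward\<close>, source and target may differ; measures have to travel
  between tower spaces and the Cantor space.\<close>

definition push :: "'b topology \<Rightarrow> ('a \<Rightarrow> 'b) \<Rightarrow> 'a measure \<Rightarrow> 'b measure" where
  "push Y f \<mu> = distr \<mu> (borel_of_top Y) f"

lemma pushforward_eq_push: "pushforward X g = push X g"
  by (auto simp: pushforward_def push_def)

lemma push_borel_prob:
  assumes "continuous_map X Y f" "\<mu> \<in> borel_prob_measures X"
  shows "push Y f \<mu> \<in> borel_prob_measures Y"
  using assms measurable_borel_of_top[OF assms] borel_prob_measuresD(1)[OF assms(2)]
  by (simp add: borel_prob_measures_def push_def prob_space.prob_space_distr)

lemma measure_push:
  assumes "continuous_map X Y f" "\<mu> \<in> borel_prob_measures X" "A \<in> sets (borel_of_top Y)"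
  shows "measure (push Y f \<mu>) A = measure \<mu> {x \<in> topspace X. f x \<in> A}"
proof -
  have "measure (push Y f \<mu>) A = measure \<mu> (f -` A \<inter> space \<mu>)"
    unfolding push_def using assms by (intro measure_distr measurable_borel_of_top)
  also have "f -` A \<inter> space \<mu> = {x \<in> topspace X. f x \<in> A}"
    using borel_prob_measuresD(3)[OF assms(2)] by auto
  finally show ?thesis .
qed

lemma push_push:
  assumes "continuous_map X Y f" "continuous_map Y Z g" "\<mu> \<in> borel_prob_measures X"
  shows "push Z g (push Y f \<mu>) = push Z (g \<circ> f) \<mu>"
  unfolding push_def
proof (rule distr_distr)
  show "f \<in> measurable \<mu> (borel_of_top Y)"
    using assms by (intro measurable_borel_of_top)
  have "g \<in> measurable (push Y f \<mu>) (borel_of_top Z)"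
    using assms push_borel_prob by (intro measurable_borel_of_top) auto
  then show "g \<in> measurable (borel_of_top Y) (borel_of_top Z)"
    by (simp add: push_def)
qed

lemma push_cong_id:
  assumes "\<mu> \<in> borel_prob_measures X" "\<And>x. x \<in> topspace X \<Longrightarrow> f x = x"
  shows "push X f \<mu> = \<mu>"
proof -
  have "push X f \<mu> = distr \<mu> \<mu> (\<lambda>x. x)"
    unfolding push_def using assms borel_prob_measuresD[OF assms(1)]
    by (intro distr_cong) auto
  then show ?thesis by simp
qed

lemma push_inverse:
  assumes "homeomorphic_maps X Y f g" "\<mu> \<in> borel_prob_measures X"
  shows "push X g (push Y f \<mu>) = \<mu>"
  using assms push_push[of X Y f X g \<mu>] push_cong_id[OF assms(2), of "g \<circ> f"]
  by (simp add: homeomorphic_maps_def)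


section \<open>Back and forth between clopen algebras\<close>

text \<open>Lists grow at the head: the nodes \<open>True # s\<close> and \<open>False # s\<close>
  are the two children of \<open>s\<close>, so the head of an address is its latest digit.\<close>

primrec address :: "(bool list \<Rightarrow> 'a set) \<Rightarrow> 'a \<Rightarrow> nat \<Rightarrow> bool list" where
  "address P x 0 = []"
| "address P x (Suc n) = (x \<in> P (True # address P x n)) # address P x n"

lemma length_address [simp]: "length (address P x n) = n"
  by (induction n) auto

text \<open>A binary tree of clopen sets in which empty nodes are allowed. The last clause says that
  the levels of the tree generate all clopen sets, so that points are determined by their
  addresses.\<close>

definition splitting_scheme :: "'a topology \<Rightarrow> (bool list \<Rightarrow> 'a set) \<Rightarrow> bool" where
  "splitting_scheme X P \<longleftrightarrow> stone_space X \<and> P [] = topspace X \<and> (\<forall>s. P s \<in> clopens X) \<and>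
     (\<forall>s. P (True # s) \<subseteq> P s) \<and> (\<forall>s. P (False # s) = P s - P (True # s)) \<and>
     (\<forall>C\<in>clopens X. \<exists>n. \<forall>s. length s = n \<longrightarrow> P s \<subseteq> C \<or> P s \<inter> C = {})"

lemma splitting_scheme_mem_iff:
  assumes "splitting_scheme X P" "x \<in> topspace X"
  shows "x \<in> P s \<longleftrightarrow> address P x (length s) = s"
proof (induction s)
  case Nil
  then show ?case using assms by (simp add: splitting_scheme_def)
next
  case (Cons t s)
  have "P (True # s) \<subseteq> P s" "P (False # s) = P s - P (True # s)"
    using assms(1) unfolding splitting_scheme_def by blast+
  then show ?case using Cons by (cases t) auto
qed

lemma splitting_scheme_mem:
  assumes "splitting_scheme X P" "x \<in> topspace X"
  shows "x \<in> P (address P x n)"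
  using splitting_scheme_mem_iff[OF assms] by simp

lemma splitting_scheme_inj:
  assumes P: "splitting_scheme X P" and x: "x \<in> topspace X" and y: "y \<in> topspace X"
    and eq: "\<And>n. address P x n = address P y n"
  shows "x = y"
proof (rule ccontr)
  assume "x \<noteq> y"
  have st: "stone_space X" using P by (simp add: splitting_scheme_def)
  obtain V where V: "V \<in> clopens X" "x \<in> V" "y \<notin> V"
    using stone_space_separate[OF st x y \<open>x \<noteq> y\<close>] .
  obtain n where n: "\<And>s. length s = n \<Longrightarrow> P s \<subseteq> V \<or> P s \<inter> V = {}"
    using P V(1) unfolding splitting_scheme_def by meson
  have "x \<in> P (address P x n)" "y \<in> P (address P x n)"
    using splitting_scheme_mem[OF P x, of n] splitting_scheme_mem[OF P y, of n] eq by auto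
  then show False using n[of "address P x n"] V by auto
qed

text \<open>The nodes of \<open>Q\<close> along the address of \<open>x\<close> decrease and are
  nonempty, so compactness gives a point with that address. Continuity holds because membership in a
  clopen set is decided at a finite depth.\<close>

lemma splitting_scheme_map:
  assumes P: "splitting_scheme X P" and Q: "splitting_scheme Y Q"
    and ne: "\<And>s. P s \<noteq> {} \<Longrightarrow> Q s \<noteq> {}"
  obtains g where "continuous_map X Y g"
    "\<And>x n. x \<in> topspace X \<Longrightarrow> address Q (g x) n = address P x n"
proof -
  have "\<exists>y\<in>topspace Y. \<forall>n. address Q y n = address P x n" if x: "x \<in> topspace X" for x
  proof -
    let ?C = "\<lambda>n. Q (address P x n)"
    have "(\<Inter>n. ?C n) \<noteq> {}"
    proof (rule stone_space_nested)
      show "stone_space Y" "\<And>n. ?C n \<in> clopens Y"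
        using Q by (auto simp: splitting_scheme_def)
      show "?C n \<noteq> {}" for n
        using splitting_scheme_mem[OF P x, of n] by (intro ne) auto
      have "Q (t # s) \<subseteq> Q s" for t s
        using Q unfolding splitting_scheme_def by (cases t) auto
      then show "decseq ?C"
        by (intro decseq_SucI) simp
    qed
    then obtain y where y: "\<And>n. y \<in> ?C n" by auto
    have "y \<in> topspace Y"
      using y[of 0] Q by (simp add: splitting_scheme_def)
    moreover have "address Q y n = address P x n" for n
      using y[of n] splitting_scheme_mem_iff[OF Q \<open>y \<in> topspace Y\<close>] by simp
    ultimately show ?thesis by blast
  qed
  then obtain g where g: "\<And>x. x \<in> topspace X \<Longrightarrow> g x \<in> topspace Y"
    "\<And>x n. x \<in> topspace X \<Longrightarrow> address Q (g x) n = address P x n"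
    by metis
  have "continuous_map X Y g"
    unfolding continuous_map_def
  proof (intro conjI allI impI)
    show "g \<in> topspace X \<rightarrow> topspace Y" using g(1) by auto
    fix U assume U: "openin Y U"
    show "openin X {x \<in> topspace X. g x \<in> U}"
    proof (subst openin_subopen, clarify)
      fix x assume x: "x \<in> topspace X" "g x \<in> U"
      have "stone_space Y" using Q by (simp add: splitting_scheme_def)
      from stone_space_clopen_nbhd[OF this U x(2)] obtain V where
        V: "V \<in> clopens Y" "g x \<in> V" "V \<subseteq> U" .
      obtain n where n: "\<And>s. length s = n \<Longrightarrow> Q s \<subseteq> V \<or> Q s \<inter> V = {}"
        using Q V(1) unfolding splitting_scheme_def by meson
      let ?s = "address P x n"
      have "g x \<in> Q ?s"
        using splitting_scheme_mem_iff[OF Q g(1)[OF x(1)], of ?s] g(2)[OF x(1)] by simp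
      then have QV: "Q ?s \<subseteq> V" using n[of ?s] V by auto
      have oP: "openin X (P ?s)" using P by (auto simp: splitting_scheme_def clopens_def)
      have "P ?s \<subseteq> {x \<in> topspace X. g x \<in> U}"
      proof
        fix z assume z: "z \<in> P ?s"
        then have zX: "z \<in> topspace X" using oP openin_subset by blast
        then have "address P z n = ?s"
          using splitting_scheme_mem_iff[OF P] z by simp
        then have "g z \<in> Q ?s"
          using splitting_scheme_mem_iff[OF Q g(1)[OF zX], of ?s] g(2)[OF zX] by simp
        then show "z \<in> {x \<in> topspace X. g x \<in> U}" using zX QV V by auto
      qed
      then show "\<exists>T. openin X T \<and> x \<in> T \<and> T \<subseteq> {x \<in> topspace X. g x \<in> U}"
        using oP splitting_scheme_mem[OF P x(1), of n] by blast
    qed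
  qed
  then show ?thesis using that g(2) by blast
qed

lemma splitting_scheme_homeomorphic:
  assumes P: "splitting_scheme X P" and Q: "splitting_scheme Y Q"
    and ne: "\<And>s. P s = {} \<longleftrightarrow> Q s = {}"
  obtains g where "homeomorphic_map X Y g" "\<And>s. g ` P s = Q s"
proof -
  obtain g where g: "continuous_map X Y g"
    "\<And>x n. x \<in> topspace X \<Longrightarrow> address Q (g x) n = address P x n"
    using splitting_scheme_map[OF P Q] ne by metis
  obtain h where h: "continuous_map Y X h"
    "\<And>x n. x \<in> topspace Y \<Longrightarrow> address P (h x) n = address Q x n"
    using splitting_scheme_map[OF Q P] ne by metis
  have gX: "g x \<in> topspace Y" if "x \<in> topspace X" for x
    using g(1) that by (auto simp: continuous_map_def)
  have hY: "h y \<in> topspace X" if "y \<in> topspace Y" for y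
    using h(1) that by (auto simp: continuous_map_def)
  have hg: "h (g x) = x" if "x \<in> topspace X" for x
    using splitting_scheme_inj[OF P, of "h (g x)" x] that gX hY g(2) h(2) by simp
  have gh: "g (h y) = y" if "y \<in> topspace Y" for y
    using splitting_scheme_inj[OF Q, of "g (h y)" y] that gX hY g(2) h(2) by simp
  have "homeomorphic_maps X Y g h"
    unfolding homeomorphic_maps_def using g(1) h(1) hg gh by auto
  moreover have "g ` P s = Q s" for s
  proof -
    have "P s \<in> clopens X" "Q s \<in> clopens Y"
      using P Q by (auto simp: splitting_scheme_def)
    then have sub: "P s \<subseteq> topspace X" "Q s \<subseteq> topspace Y"
      by (auto dest: clopens_subset)
    show ?thesis
    proof (intro equalityI subsetI)
      fix y assume "y \<in> g ` P s"
      then obtain x where x: "x \<in> P s" "x \<in> topspace X" "y = g x" using sub by auto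
      then show "y \<in> Q s"
        using splitting_scheme_mem_iff[OF P x(2)] splitting_scheme_mem_iff[OF Q gX[OF x(2)]] g(2)
        by simp
    next
      fix y assume y: "y \<in> Q s"
      then have yY: "y \<in> topspace Y" using sub by auto
      have "h y \<in> P s"
        using y splitting_scheme_mem_iff[OF P hY[OF yY]] splitting_scheme_mem_iff[OF Q yY] h(2)[OF yY]
        by simp
      then show "y \<in> g ` P s" using gh[OF yY] by force
    qed
  qed
  ultimately show ?thesis using that homeomorphic_map_maps by blast
qed

lemma splitting_scheme_clopen_Union:
  assumes P: "splitting_scheme X P" and C: "C \<in> clopens X"
  obtains n where "C = (\<Union>s\<in>{s. length s = n \<and> P s \<subseteq> C}. P s)"
proof -
  obtain n where n: "\<And>s. length s = n \<Longrightarrow> P s \<subseteq> C \<or> P s \<inter> C = {}"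
    using P C unfolding splitting_scheme_def by meson
  have "x \<in> (\<Union>s\<in>{s. length s = n \<and> P s \<subseteq> C}. P s)" if "x \<in> C" for x
  proof -
    have "x \<in> P (address P x n)"
      using that clopens_subset[OF C] by (intro splitting_scheme_mem[OF P]) auto
    moreover have "P (address P x n) \<subseteq> C"
      using n[of "address P x n"] that calculation by auto
    ultimately show ?thesis by (intro UN_I[of "address P x n"]) auto
  qed
  then have "C = (\<Union>s\<in>{s. length s = n \<and> P s \<subseteq> C}. P s)" by auto
  then show ?thesis by (rule that)
qed

text \<open>Both trees grow together as pairs of sets. The function \<open>f\<close> proposes the
  \<open>True\<close> child of a pair at a given depth, and the \<open>False\<close> child is its
  complement in both components.\<close>

primrec split_tree :: "(nat \<Rightarrow> 'a set \<times> 'b set \<Rightarrow> 'a set \<times> 'b set) \<Rightarrow> 'a set \<times> 'b set \<Rightarrow>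
    bool list \<Rightarrow> 'a set \<times> 'b set" where
  "split_tree f p [] = p"
| "split_tree f p (t # s) =
     (let q = split_tree f p s; c = f (length s) q
      in if t then c else (fst q - fst c, snd q - snd c))"

text \<open>The relation \<open>R\<close> plays the role of a partial isomorphism type. Cutting by
  the clopen sets of both spaces in turn makes both components splitting schemes with the same empty
  nodes, which gives the homeomorphism. Closure of \<open>R\<close> under disjoint unions carries it
  from nodes to all clopen sets.\<close>

theorem stone_back_and_forth:
  fixes X :: "'a topology" and Y :: "'b topology"
  assumes X: "stone_space X" and Y: "stone_space Y"
    and top: "R (topspace X) (topspace Y)"
    and empty: "\<And>A B. A \<in> clopens X \<Longrightarrow> B \<in> clopens Y \<Longrightarrow> R A B \<Longrightarrow> A = {} \<longleftrightarrow> B = {}"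
    and forth: "\<And>A B C. A \<in> clopens X \<Longrightarrow> B \<in> clopens Y \<Longrightarrow> R A B \<Longrightarrow> C \<in> clopens X \<Longrightarrow> C \<subseteq> A
      \<Longrightarrow> \<exists>D\<in>clopens Y. D \<subseteq> B \<and> R C D \<and> R (A - C) (B - D)"
    and fro: "\<And>A B D. A \<in> clopens X \<Longrightarrow> B \<in> clopens Y \<Longrightarrow> R A B \<Longrightarrow> D \<in> clopens Y \<Longrightarrow> D \<subseteq> B
      \<Longrightarrow> \<exists>C\<in>clopens X. C \<subseteq> A \<and> R C D \<and> R (A - C) (B - D)"
    and un: "\<And>A B C D. A \<in> clopens X \<Longrightarrow> B \<in> clopens Y \<Longrightarrow> C \<in> clopens X \<Longrightarrow> D \<in> clopens Y
      \<Longrightarrow> R A B \<Longrightarrow> R C D \<Longrightarrow> A \<inter> C = {} \<Longrightarrow> B \<inter> D = {} \<Longrightarrow> R (A \<union> C) (B \<union> D)"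
  shows "\<exists>g. homeomorphic_map X Y g \<and> (\<forall>A\<in>clopens X. R A (g ` A))"
proof -
  define a where "a = from_nat_into (clopens X)"
  define b where "b = from_nat_into (clopens Y)"
  have a: "range a = clopens X" and b: "range b = clopens Y"
    unfolding a_def b_def
    by (rule range_from_nat_into; use countable_clopens X Y clopens_empty in blast)+
  \<comment> \<open>Depth \<open>n\<close> treats the clopen set numbered \<open>n div 2\<close>, on
    the side chosen by the parity of \<open>n\<close>; thus each clopen set of either space is used
    at some depth.\<close>
  define ok where "ok n p c \<longleftrightarrow> fst c \<in> clopens X \<and> snd c \<in> clopens Y \<and>
      fst c \<subseteq> fst p \<and> snd c \<subseteq> snd p \<and> R (fst c) (snd c) \<and> R (fst p - fst c) (snd p - snd c) \<and>
      (if even n then fst c = fst p \<inter> a (n div 2) else snd c = snd p \<inter> b (n div 2))"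
    for n :: nat and p c
  have ex: "\<exists>c. ok n p c" if p: "fst p \<in> clopens X" "snd p \<in> clopens Y" "R (fst p) (snd p)" for n p
  proof (cases "even n")
    case True
    have "a (n div 2) \<in> clopens X" using a by blast
    then obtain D where "D\<in>clopens Y" "D \<subseteq> snd p" "R (fst p \<inter> a (n div 2)) D"
      "R (fst p - fst p \<inter> a (n div 2)) (snd p - D)"
      using forth[OF p clopens_Int[OF p(1)] Int_lower1] by metis
    then show ?thesis
      using True p clopens_Int \<open>a (n div 2) \<in> clopens X\<close>
      by (intro exI[of _ "(fst p \<inter> a (n div 2), D)"]) (auto simp: ok_def)
  next
    case False
    have "b (n div 2) \<in> clopens Y" using b by blast
    then obtain C where "C\<in>clopens X" "C \<subseteq> fst p" "R C (snd p \<inter> b (n div 2))"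
      "R (fst p - C) (snd p - snd p \<inter> b (n div 2))"
      using fro[OF p clopens_Int[OF p(2)] Int_lower1] by metis
    then show ?thesis
      using False p clopens_Int \<open>b (n div 2) \<in> clopens Y\<close>
      by (intro exI[of _ "(C, snd p \<inter> b (n div 2))"]) (auto simp: ok_def)
  qed
  define f where "f n p = (SOME c. ok n p c)" for n p
  have f: "ok n p (f n p)" if "fst p \<in> clopens X" "snd p \<in> clopens Y" "R (fst p) (snd p)" for n p
    unfolding f_def using ex[OF that] by (rule someI_ex)
  define T where "T = split_tree f (topspace X, topspace Y)"
  have T: "fst (T s) \<in> clopens X \<and> snd (T s) \<in> clopens Y \<and> R (fst (T s)) (snd (T s))" for s
  proof (induction s)
    case Nil
    then show ?case using top by (simp add: T_def)
  next
    case (Cons t s)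
    have "T (t # s) = (let c = f (length s) (T s) in if t then c else (fst (T s) - fst c, snd (T s) - snd c))"
      by (simp add: T_def Let_def)
    then show ?case
      using f[of "T s" "length s"] Cons unfolding ok_def
      by (cases t) (auto simp: Let_def clopens_Diff)
  qed
  have okT: "ok (length s) (T s) (T (True # s))" for s
    using f[of "T s" "length s"] T[of s] by (simp add: T_def Let_def)
  have TF: "T (False # s) = (fst (T s) - fst (T (True # s)), snd (T s) - snd (T (True # s)))" for s
    by (simp add: T_def Let_def)
  define P where "P s = fst (T s)" for s
  define Q where "Q s = snd (T s)" for s
  have sepP: "\<exists>n. \<forall>s. length s = n \<longrightarrow> P s \<subseteq> C \<or> P s \<inter> C = {}" if C: "C \<in> clopens X" for C
  proof -
    obtain k where k: "C = a k" using a C by blast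
    have "P s \<subseteq> C \<or> P s \<inter> C = {}" if l: "length s = Suc (2 * k)" for s
    proof -
      obtain t u where s: "s = t # u" "length u = 2 * k" using l by (cases s) auto
      have "P (True # u) = P u \<inter> C" using okT[of u] s k by (simp add: ok_def P_def)
      moreover have "P (False # u) = P u - P (True # u)" using TF by (simp add: P_def)
      ultimately show ?thesis using s by (cases t) auto
    qed
    then show ?thesis by blast
  qed
  have sepQ: "\<exists>n. \<forall>s. length s = n \<longrightarrow> Q s \<subseteq> C \<or> Q s \<inter> C = {}" if C: "C \<in> clopens Y" for C
  proof -
    obtain k where k: "C = b k" using b C by blast
    have "Q s \<subseteq> C \<or> Q s \<inter> C = {}" if l: "length s = Suc (Suc (2 * k))" for s
    proof -
      obtain t u where s: "s = t # u" "length u = Suc (2 * k)" using l by (cases s) auto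
      have "Q (True # u) = Q u \<inter> C" using okT[of u] s k by (simp add: ok_def Q_def)
      moreover have "Q (False # u) = Q u - Q (True # u)" using TF by (simp add: Q_def)
      ultimately show ?thesis using s by (cases t) auto
    qed
    then show ?thesis by blast
  qed
  have P: "splitting_scheme X P"
    unfolding splitting_scheme_def
  proof (intro conjI allI ballI)
    show "stone_space X" "P [] = topspace X" using X by (auto simp: P_def T_def)
    show "P s \<in> clopens X" "P (True # s) \<subseteq> P s" "P (False # s) = P s - P (True # s)" for s
      using T[of s] okT[of s] TF[of s] by (auto simp: P_def ok_def)
  qed (rule sepP)
  have Q: "splitting_scheme Y Q"
    unfolding splitting_scheme_def
  proof (intro conjI allI ballI)
    show "stone_space Y" "Q [] = topspace Y" using Y by (auto simp: Q_def T_def)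
    show "Q s \<in> clopens Y" "Q (True # s) \<subseteq> Q s" "Q (False # s) = Q s - Q (True # s)" for s
      using T[of s] okT[of s] TF[of s] by (auto simp: Q_def ok_def)
  qed (rule sepQ)
  have R: "P s \<in> clopens X" "Q s \<in> clopens Y" "R (P s) (Q s)" for s
    using T[of s] by (auto simp: P_def Q_def)
  obtain g where g: "homeomorphic_map X Y g" "\<And>s. g ` P s = Q s"
    using splitting_scheme_homeomorphic[OF P Q] R empty by metis
  \<comment> \<open>Splitting off the empty set from the whole space yields a partner of the empty
    set, which must itself be empty. This is the base case for finite unions of nodes.\<close>
  have R0: "R {} {}"
    using forth[OF clopens_topspace clopens_topspace top, of "{}"] empty by (metis clopens_empty empty_subsetI)
  have inj: "inj_on g (topspace X)"
    using g(1) by (simp add: homeomorphic_map_def)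
  have disj: "P s \<inter> P s' = {} \<and> Q s \<inter> Q s' = {}" if "length s = length s'" "s \<noteq> s'" for s s'
  proof -
    have "P s \<inter> P s' = {}"
      using splitting_scheme_mem_iff[OF P] that clopens_subset[OF R(1)[of s]] by fastforce
    moreover have "Q s \<inter> Q s' = {}"
      using splitting_scheme_mem_iff[OF Q] that clopens_subset[OF R(2)[of s]] by fastforce
    ultimately show ?thesis by blast
  qed
  have RU: "R (\<Union>s\<in>S. P s) (\<Union>s\<in>S. Q s)" if "finite S" "\<And>s. s \<in> S \<Longrightarrow> length s = n" for S n
    using that
  proof (induction S rule: finite_induct)
    case empty
    then show ?case using R0 by simp
  next
    case (insert s S)
    have "R (P s \<union> (\<Union>s\<in>S. P s)) (Q s \<union> (\<Union>s\<in>S. Q s))"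
    proof (rule un)
      show "P s \<in> clopens X" "Q s \<in> clopens Y" "R (P s) (Q s)" using R by auto
      show "(\<Union>s\<in>S. P s) \<in> clopens X" "(\<Union>s\<in>S. Q s) \<in> clopens Y"
        using insert(1) R by (auto intro!: clopens_Union)
      show "R (\<Union>s\<in>S. P s) (\<Union>s\<in>S. Q s)" using insert by auto
      have "P s \<inter> P s' = {} \<and> Q s \<inter> Q s' = {}" if "s' \<in> S" for s'
        using disj[of s s'] insert that by auto
      then show "P s \<inter> (\<Union>s\<in>S. P s) = {}" "Q s \<inter> (\<Union>s\<in>S. Q s) = {}" by blast+
    qed
    then show ?case by simp
  qed
  have "R A (g ` A)" if A: "A \<in> clopens X" for A
  proof -
    obtain n where n: "A = (\<Union>s\<in>{s. length s = n \<and> P s \<subseteq> A}. P s)"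
      using splitting_scheme_clopen_Union[OF P A] .
    let ?S = "{s. length s = n \<and> P s \<subseteq> A}"
    have "g ` A = (\<Union>s\<in>?S. Q s)"
      using n g(2) by (metis (no_types, lifting) SUP_cong image_UN)
    moreover have "finite ?S"
      by (rule finite_subset[OF _ finite_lists_length_eq[of "UNIV :: bool set" n]]) auto
    then have "R (\<Union>s\<in>?S. P s) (\<Union>s\<in>?S. Q s)"
      by (rule RU[of _ n]) auto
    ultimately show ?thesis using n by simp
  qed
  then show ?thesis using g(1) by blast
qed


section \<open>Closed sets of sequences\<close>

abbreviation seq_product :: "(nat \<Rightarrow> 'a) topology" where
  "seq_product \<equiv> product_topology (\<lambda>_. discrete_topology UNIV) UNIV"

definition seq_top :: "(nat \<Rightarrow> 'a) set \<Rightarrow> (nat \<Rightarrow> 'a) topology" where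
  "seq_top S = subtopology seq_product S"

lemma topspace_seq_top [simp]: "topspace (seq_top S) = S"
  by (simp add: seq_top_def)

lemma openin_seq_product:
  "openin seq_product U \<longleftrightarrow> (\<forall>x\<in>U. \<exists>n. \<forall>y. (\<forall>i<n. y i = x i) \<longrightarrow> y \<in> U)"
proof
  assume L: "openin seq_product U"
  show "\<forall>x\<in>U. \<exists>n. \<forall>y. (\<forall>i<n. y i = x i) \<longrightarrow> y \<in> U"
  proof
    fix x assume "x \<in> U"
    then obtain V where V: "finite {i. V i \<noteq> UNIV}" "x \<in> Pi\<^sub>E UNIV V" "Pi\<^sub>E UNIV V \<subseteq> U"
      using L unfolding openin_product_topology_alt by auto
    obtain n where n: "{i. V i \<noteq> UNIV} \<subseteq> {..<n}"
      using V(1) finite_nat_iff_bounded by blast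
    have "y \<in> U" if "\<forall>i<n. y i = x i" for y
    proof -
      have "y i \<in> V i" for i
        using that n V(2) by (cases "i < n") (auto simp: PiE_def Pi_def)
      then show ?thesis using V(3) by (auto simp: PiE_def Pi_def)
    qed
    then show "\<exists>n. \<forall>y. (\<forall>i<n. y i = x i) \<longrightarrow> y \<in> U" by blast
  qed
next
  assume R: "\<forall>x\<in>U. \<exists>n. \<forall>y. (\<forall>i<n. y i = x i) \<longrightarrow> y \<in> U"
  show "openin seq_product U"
    unfolding openin_product_topology_alt
  proof
    fix x assume "x \<in> U"
    then obtain n where n: "\<And>y. (\<forall>i<n. y i = x i) \<Longrightarrow> y \<in> U" using R by metis
    let ?V = "\<lambda>i. if i < n then {x i} else UNIV"
    have "finite {i \<in> UNIV. ?V i \<noteq> topspace (discrete_topology UNIV)}"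
      by (rule finite_subset[of _ "{..<n}"]) auto
    moreover have "Pi\<^sub>E UNIV ?V \<subseteq> U"
    proof
      fix y assume "y \<in> Pi\<^sub>E UNIV ?V"
      then have "y i \<in> ?V i" for i by (auto simp: PiE_def Pi_def)
      then have "\<forall>i<n. y i = x i" by (metis (full_types) singletonD)
      then show "y \<in> U" by (rule n)
    qed
    moreover have "x \<in> Pi\<^sub>E UNIV ?V" by auto
    ultimately show "\<exists>V. finite {i \<in> UNIV. V i \<noteq> topspace (discrete_topology UNIV)} \<and>
        (\<forall>i\<in>UNIV. openin (discrete_topology UNIV) (V i)) \<and> x \<in> Pi\<^sub>E UNIV V \<and> Pi\<^sub>E UNIV V \<subseteq> U"
      by (intro exI[of _ ?V]) auto
  qed
qed

lemma openin_seq_top: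
  "openin (seq_top S) U \<longleftrightarrow>
     U \<subseteq> S \<and> (\<forall>x\<in>U. \<exists>n. \<forall>y\<in>S. (\<forall>i<n. y i = x i) \<longrightarrow> y \<in> U)"
proof
  assume "openin (seq_top S) U"
  then obtain T where T: "openin seq_product T" "U = T \<inter> S"
    unfolding seq_top_def openin_subtopology by blast
  have "\<exists>n. \<forall>y\<in>S. (\<forall>i<n. y i = x i) \<longrightarrow> y \<in> U" if "x \<in> U" for x
  proof -
    have "\<exists>n. \<forall>y. (\<forall>i<n. y i = x i) \<longrightarrow> y \<in> T"
      using T that by (intro bspec[OF openin_seq_product[THEN iffD1, OF T(1)]]) auto
    then show ?thesis unfolding T(2) by auto
  qed
  then show "U \<subseteq> S \<and> (\<forall>x\<in>U. \<exists>n. \<forall>y\<in>S. (\<forall>i<n. y i = x i) \<longrightarrow> y \<in> U)"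
    using T(2) by blast
next
  assume R: "U \<subseteq> S \<and> (\<forall>x\<in>U. \<exists>n. \<forall>y\<in>S. (\<forall>i<n. y i = x i) \<longrightarrow> y \<in> U)"
  \<comment> \<open>The open set of the ambient product is assembled from those cylinders whose
    trace on \<open>S\<close> already lies in \<open>U\<close>.\<close>
  define T where "T = {y. \<exists>x\<in>U. \<exists>n. (\<forall>i<n. y i = x i) \<and> (\<forall>z\<in>S. (\<forall>i<n. z i = x i) \<longrightarrow> z \<in> U)}"
  have "openin seq_product T"
    unfolding openin_seq_product
  proof
    fix y assume "y \<in> T"
    then obtain x n where x: "x \<in> U" "\<forall>i<n. y i = x i" "\<forall>z\<in>S. (\<forall>i<n. z i = x i) \<longrightarrow> z \<in> U"
      unfolding T_def by blast
    have "y' \<in> T" if "\<forall>i<n. y' i = y i" for y'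
      unfolding T_def using x that by auto
    then show "\<exists>n. \<forall>y'. (\<forall>i<n. y' i = y i) \<longrightarrow> y' \<in> T" by blast
  qed
  moreover have "U = T \<inter> S"
  proof (intro equalityI subsetI)
    fix x assume x: "x \<in> U"
    then obtain n where "\<forall>z\<in>S. (\<forall>i<n. z i = x i) \<longrightarrow> z \<in> U" using R by blast
    then have "x \<in> T" unfolding T_def using x by blast
    then show "x \<in> T \<inter> S" using x R by blast
  next
    fix x assume "x \<in> T \<inter> S"
    then show "x \<in> U" unfolding T_def by blast
  qed
  ultimately show "openin (seq_top S) U"
    unfolding seq_top_def openin_subtopology by blast
qed

lemma openin_seq_topD:
  assumes "openin (seq_top S) U" "x \<in> U"
  obtains n where "\<forall>y\<in>S. (\<forall>i<n. y i = x i) \<longrightarrow> y \<in> U"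
proof -
  have "\<exists>n. \<forall>y\<in>S. (\<forall>i<n. y i = x i) \<longrightarrow> y \<in> U"
    using assms by (intro bspec[OF conjunct2[OF openin_seq_top[THEN iffD1]]])
  then show ?thesis by (elim exE) (rule that)
qed

lemma seq_top_cylinder:
  "{x \<in> S. \<forall>i<n. Q i (x i)} \<in> clopens (seq_top S)"
proof -
  have "openin (seq_top S) {x \<in> S. \<forall>i<n. Q i (x i)}"
    unfolding openin_seq_top by (auto intro!: exI[of _ n])
  moreover have "openin (seq_top S) (S - {x \<in> S. \<forall>i<n. Q i (x i)})"
    unfolding openin_seq_top
  proof (intro conjI ballI)
    fix x assume x: "x \<in> S - {x \<in> S. \<forall>i<n. Q i (x i)}"
    then obtain i where "i < n" "\<not> Q i (x i)" by auto
    then show "\<exists>n'. \<forall>y\<in>S. (\<forall>i<n'. y i = x i) \<longrightarrow> y \<in> S - {x \<in> S. \<forall>i<n. Q i (x i)}"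
      by (intro exI[of _ "Suc i"]) auto
  qed auto
  ultimately show ?thesis
    by (simp add: clopens_def closedin_def)
qed

lemma seq_top_coordinate:
  "{x \<in> S. x n \<in> A} \<in> clopens (seq_top S)"
proof -
  have "{x \<in> S. x n \<in> A} = {x \<in> S. \<forall>i<Suc n. i = n \<longrightarrow> x i \<in> A}" by auto
  then show ?thesis using seq_top_cylinder[of S "Suc n" "\<lambda>i z. i = n \<longrightarrow> z \<in> A"] by simp
qed

text \<open>A closed subset of a product of finite sets is compact; closedness is stated as: a
  sequence all of whose prefixes extend to members of \<open>S\<close> is in \<open>S\<close>.
  Countability of the alphabet gives a countable base of cylinders.\<close>

lemma stone_space_seq_top:
  fixes S :: "(nat \<Rightarrow> 'a::countable) set"
  assumes fin: "\<And>n. finite (Z n)" and Z: "\<And>x n. x \<in> S \<Longrightarrow> x n \<in> Z n"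
    and closed: "\<And>x. (\<And>n. \<exists>y\<in>S. \<forall>i<n. y i = x i) \<Longrightarrow> x \<in> S"
  shows "stone_space (seq_top S)"
  unfolding stone_space_def
proof (intro conjI)
  have "openin seq_product (- S)"
    unfolding openin_seq_product
  proof
    fix x assume "x \<in> - S"
    then obtain n where n: "\<not> (\<exists>y\<in>S. \<forall>i<n. y i = x i)" using closed[of x] by blast
    show "\<exists>n. \<forall>y. (\<forall>i<n. y i = x i) \<longrightarrow> y \<in> - S"
      by (rule exI[of _ n]) (use n in blast)
  qed
  then have "closedin seq_product S"
    by (simp add: closedin_def Compl_eq_Diff_UNIV)
  moreover have "compactin seq_product (Pi\<^sub>E UNIV Z)"
    using fin by (auto simp: compactin_PiE compactin_discrete_topology)
  moreover have "S \<subseteq> Pi\<^sub>E UNIV Z" using Z by auto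
  ultimately have "compactin seq_product S" by (rule closed_compactin[rotated 2])
  then show "compact_space (seq_top S)"
    unfolding seq_top_def by (rule compact_space_subtopology)
  show "Hausdorff_space (seq_top S)"
    unfolding seq_top_def by (intro Hausdorff_space_subtopology) (simp add: Hausdorff_space_product_topology)
  let ?cyl = "\<lambda>l. {x \<in> S. \<forall>i<length l. x i = l ! i}"
  show "\<exists>\<B>. countable \<B> \<and> \<B> \<subseteq> clopens (seq_top S) \<and>
      (\<forall>U x. openin (seq_top S) U \<and> x \<in> U \<longrightarrow> (\<exists>V\<in>\<B>. x \<in> V \<and> V \<subseteq> U))"
  proof (intro exI[of _ "range ?cyl"] conjI allI impI)
    show "countable (range ?cyl)" by simp
    show "range ?cyl \<subseteq> clopens (seq_top S)"
      using seq_top_cylinder[of S _ "\<lambda>i z. z = _ i"] by auto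
    fix U x assume U: "openin (seq_top S) U \<and> x \<in> U"
    then have op: "openin (seq_top S) U" and xU: "x \<in> U" by auto
    then have "x \<in> S" using openin_subset[OF op] by auto
    obtain n where n: "\<forall>y\<in>S. (\<forall>i<n. y i = x i) \<longrightarrow> y \<in> U"
      by (rule openin_seq_topD[OF op xU])
    have "x \<in> ?cyl (map x [0..<n])" "?cyl (map x [0..<n]) \<subseteq> U"
      using n \<open>x \<in> S\<close> by auto
    then show "\<exists>V\<in>range ?cyl. x \<in> V \<and> V \<subseteq> U"
      by (intro bexI[of _ "?cyl (map x [0..<n])"] conjI rangeI)
  qed
qed

lemma cantor_eq_seq_top: "(seq_product :: (nat \<Rightarrow> bool) topology) = seq_top UNIV"
  by (simp add: seq_top_def)

lemma stone_space_cantor: "stone_space (seq_product :: (nat \<Rightarrow> bool) topology)"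
  unfolding cantor_eq_seq_top by (rule stone_space_seq_top[of "\<lambda>_. UNIV"]) simp_all

section \<open>Stone spaces without isolated points\<close>

text \<open>For a Stone space, absence of atoms in the clopen algebra is absence of isolated
  points.\<close>

definition atomless :: "'a topology \<Rightarrow> bool" where
  "atomless X \<longleftrightarrow> (\<forall>A\<in>clopens X. A \<noteq> {} \<longrightarrow> (\<exists>B\<in>clopens X. B \<subseteq> A \<and> B \<noteq> {} \<and> B \<noteq> A))"

lemma atomless_cantor: "atomless (seq_product :: (nat \<Rightarrow> bool) topology)"
  unfolding cantor_eq_seq_top atomless_def
proof (intro ballI impI)
  fix A :: "(nat \<Rightarrow> bool) set" assume A: "A \<in> clopens (seq_top UNIV)" "A \<noteq> {}"
  then obtain x where x: "x \<in> A" by blast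
  have "openin (seq_top UNIV) A" using A(1) by (simp add: clopens_def)
  then obtain n where n: "\<forall>y\<in>UNIV. (\<forall>i<n. y i = x i) \<longrightarrow> y \<in> A"
    by (rule openin_seq_topD[OF _ x])
  let ?B = "A \<inter> {y \<in> UNIV. y n \<in> {x n}}"
  have B: "?B \<in> clopens (seq_top UNIV)"
    by (intro clopens_Int A seq_top_coordinate)
  \<comment> \<open>Membership in \<open>A\<close> near \<open>x\<close> depends only on the
    coordinates below \<open>n\<close>, so flipping coordinate \<open>n\<close> stays in
    \<open>A\<close> but leaves \<open>?B\<close>.\<close>
  have "x(n := \<not> x n) \<in> A" by (rule n[rule_format]) simp_all
  moreover have "x(n := \<not> x n) \<notin> ?B" by simp
  ultimately have "?B \<noteq> A" by metis
  moreover have "x \<in> ?B" using x by simp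
  ultimately show "\<exists>B\<in>clopens (seq_top UNIV). B \<subseteq> A \<and> B \<noteq> {} \<and> B \<noteq> A"
    by (intro bexI[OF _ B] conjI Int_lower1) auto
qed

lemma atomless_split:
  assumes "atomless Y" "A \<in> clopens X" "B \<in> clopens Y" "A = {} \<longleftrightarrow> B = {}" "C \<subseteq> A"
  shows "\<exists>D\<in>clopens Y. D \<subseteq> B \<and> (C = {} \<longleftrightarrow> D = {}) \<and> (A - C = {} \<longleftrightarrow> B - D = {})"
proof -
  consider "C = {}" | "C = A" | "C \<noteq> {}" "C \<noteq> A" by blast
  then show ?thesis
  proof cases
    case 1
    then show ?thesis using assms(4) by (intro bexI[of _ "{}"]) simp_all
  next
    case 2
    then show ?thesis using assms(3,4) by (intro bexI[of _ B]) simp_all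
  next
    case 3
    then have "B \<noteq> {}" using assms(4,5) by auto
    then have "\<exists>D\<in>clopens Y. D \<subseteq> B \<and> D \<noteq> {} \<and> D \<noteq> B"
      using assms(1,3) unfolding atomless_def by simp
    then obtain D where D: "D \<in> clopens Y" "D \<subseteq> B" "D \<noteq> {}" "D \<noteq> B"
      by (elim bexE conjE)
    have "A - C \<noteq> {}" "B - D \<noteq> {}" using 3 assms(5) D by auto
    then show ?thesis using 3 D by (intro bexI[of _ D] conjI) simp_all
  qed
qed

text \<open>Brouwer's characterisation of the Cantor set, by back and forth with the weakest
  relation: both sets are empty or both are nonempty.\<close>

lemma atomless_stone_homeomorphic:
  assumes "stone_space X" "stone_space Y" "atomless X" "atomless Y"
    "topspace X \<noteq> {}" "topspace Y \<noteq> {}"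
  obtains e where "homeomorphic_map X Y e"
proof -
  let ?R = "\<lambda>A B. A = {} \<longleftrightarrow> B = {}"
  have "\<exists>e. homeomorphic_map X Y e \<and> (\<forall>A\<in>clopens X. ?R A (e ` A))"
  proof (rule stone_back_and_forth[OF assms(1,2)])
    fix A B C assume "A \<in> clopens X" "B \<in> clopens Y" "?R A B" "C \<in> clopens X" "C \<subseteq> A"
    then show "\<exists>D\<in>clopens Y. D \<subseteq> B \<and> ?R C D \<and> ?R (A - C) (B - D)"
      by (intro atomless_split[OF assms(4)])
  next
    fix A B D assume *: "A \<in> clopens X" "B \<in> clopens Y" "?R A B" "D \<in> clopens Y" "D \<subseteq> B"
    have "\<exists>C\<in>clopens X. C \<subseteq> A \<and> ?R D C \<and> ?R (B - D) (A - C)"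
      by (rule atomless_split[OF assms(3) *(2,1) *(3)[symmetric] *(5)])
    then show "\<exists>C\<in>clopens X. C \<subseteq> A \<and> ?R C D \<and> ?R (A - C) (B - D)"
      by (elim bexE, intro bexI) simp_all
  next
    show "?R (topspace X) (topspace Y)" using assms(5,6) by metis
  qed auto
  then show ?thesis using that by (elim exE conjE)
qed

section \<open>Transport of dynamical simplices\<close>

lemma invariant_measures_subset: "invariant_measures X \<phi> \<subseteq> borel_prob_measures X"
  by (auto simp: invariant_measures_def)

lemma dynamical_simplex_subset: "dynamical_simplex X K \<Longrightarrow> K \<subseteq> borel_prob_measures X"
  by (auto simp: dynamical_simplex_def invariant_measures_def)

lemma invariant_measures_conjugate:
  assumes e: "homeomorphic_maps X Y e d" and \<phi>: "continuous_map X X \<phi>"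
    and \<mu>: "\<mu> \<in> invariant_measures X \<phi>"
  shows "push Y e \<mu> \<in> invariant_measures Y (e \<circ> \<phi> \<circ> d)"
proof -
  have ce: "continuous_map X Y e" and cd: "continuous_map Y X d"
    using e by (auto simp: homeomorphic_maps_def)
  have m: "\<mu> \<in> borel_prob_measures X" "push X \<phi> \<mu> = \<mu>"
    using \<mu> by (auto simp: invariant_measures_def pushforward_eq_push)
  have "push Y (e \<circ> \<phi> \<circ> d) (push Y e \<mu>) = push Y (e \<circ> \<phi>) (push X d (push Y e \<mu>))"
    using push_push[OF cd continuous_map_compose[OF \<phi> ce] push_borel_prob[OF ce m(1)]] by simp
  also have "\<dots> = push Y e (push X \<phi> \<mu>)"
    using push_inverse[OF e m(1)] push_push[OF \<phi> ce m(1)] by simp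
  finally show ?thesis
    using m push_borel_prob[OF ce] by (simp add: invariant_measures_def pushforward_eq_push)
qed

lemma two_sided_orbitI:
  "y \<in> topspace X \<Longrightarrow> y = (\<phi> ^^ n) x \<or> (\<phi> ^^ n) y = x \<Longrightarrow> y \<in> two_sided_orbit X \<phi> x"
  unfolding two_sided_orbit_def by (intro CollectI conjI exI)

lemma minimal_homeomorphism_conjugate:
  assumes e: "homeomorphic_maps X Y e d" and \<phi>: "minimal_homeomorphism X \<phi>"
  shows "minimal_homeomorphism Y (e \<circ> \<phi> \<circ> d)"
  unfolding minimal_homeomorphism_def
proof (intro conjI ballI)
  have eX: "homeomorphic_map X Y e" and dX: "homeomorphic_map Y X d"
    using homeomorphic_maps_imp_map[OF e] homeomorphic_maps_imp_map[OF homeomorphic_maps_sym[THEN iffD1, OF e]] .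
  have hp: "homeomorphic_map X X \<phi>" using \<phi> by (simp add: minimal_homeomorphism_def)
  then show "homeomorphic_map Y Y (e \<circ> \<phi> \<circ> d)"
    by (intro homeomorphic_map_compose[OF dX] homeomorphic_map_compose[OF hp eX])
  have de: "d (e x) = x" "e x \<in> topspace Y" if "x \<in> topspace X" for x
    using e that by (auto simp: homeomorphic_maps_def continuous_map_def)
  have ed: "e (d y) = y" "d y \<in> topspace X" if "y \<in> topspace Y" for y
    using e that by (auto simp: homeomorphic_maps_def continuous_map_def)
  have pX: "\<phi> x \<in> topspace X" if "x \<in> topspace X" for x
    using homeomorphic_imp_surjective_map[OF hp] that by auto
  have iter: "(\<phi> ^^ n) x \<in> topspace X \<and> ((e \<circ> \<phi> \<circ> d) ^^ n) (e x) = e ((\<phi> ^^ n) x)"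
    if "x \<in> topspace X" for n x
    using that by (induction n) (auto simp: pX de)
  fix y assume y: "y \<in> topspace Y"
  have "two_sided_orbit Y (e \<circ> \<phi> \<circ> d) y = e ` two_sided_orbit X \<phi> (d y)"
  proof (intro equalityI subsetI)
    fix z assume "z \<in> two_sided_orbit Y (e \<circ> \<phi> \<circ> d) y"
    then obtain n where z: "z \<in> topspace Y"
      and n: "z = ((e \<circ> \<phi> \<circ> d) ^^ n) y \<or> ((e \<circ> \<phi> \<circ> d) ^^ n) z = y"
      unfolding two_sided_orbit_def by blast
    have "d z = (\<phi> ^^ n) (d y) \<or> (\<phi> ^^ n) (d z) = d y"
      using n iter[of "d y" n] iter[of "d z" n] ed[OF y] ed[OF z] de by metis
    then have "d z \<in> two_sided_orbit X \<phi> (d y)"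
      using ed[OF z] by (intro two_sided_orbitI)
    then show "z \<in> e ` two_sided_orbit X \<phi> (d y)"
      using ed[OF z] by force
  next
    fix z assume "z \<in> e ` two_sided_orbit X \<phi> (d y)"
    then obtain w n where w: "z = e w" "w \<in> topspace X"
      and n: "w = (\<phi> ^^ n) (d y) \<or> (\<phi> ^^ n) w = d y"
      unfolding two_sided_orbit_def by blast
    have "z = ((e \<circ> \<phi> \<circ> d) ^^ n) y \<or> ((e \<circ> \<phi> \<circ> d) ^^ n) z = y"
      using n w iter[of "d y" n] iter[of w n] ed[OF y] by metis
    then show "z \<in> two_sided_orbit Y (e \<circ> \<phi> \<circ> d) y"
      using w de(2)[OF w(2)] by (intro two_sided_orbitI) simp_all
  qed
  moreover have "two_sided_orbit X \<phi> (d y) \<subseteq> topspace X"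
    by (auto simp: two_sided_orbit_def)
  then have "Y closure_of (e ` two_sided_orbit X \<phi> (d y)) = e ` (X closure_of two_sided_orbit X \<phi> (d y))"
    using homeomorphic_map_closure_of[OF eX] by blast
  moreover have "X closure_of two_sided_orbit X \<phi> (d y) = topspace X"
    using \<phi> ed[OF y] by (simp add: minimal_homeomorphism_def)
  ultimately show "Y closure_of two_sided_orbit Y (e \<circ> \<phi> \<circ> d) y = topspace Y"
    using homeomorphic_imp_surjective_map[OF eX] by simp
qed

lemma dynamical_simplex_transport:
  assumes e: "homeomorphic_maps X Y e d" and K: "dynamical_simplex X K"
  shows "dynamical_simplex Y (push Y e ` K)"
proof -
  obtain \<phi> where \<phi>: "minimal_homeomorphism X \<phi>" "K = invariant_measures X \<phi>"
    using K by (auto simp: dynamical_simplex_def)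
  let ?\<psi> = "e \<circ> \<phi> \<circ> d"
  have d: "homeomorphic_maps Y X d e" by (rule homeomorphic_maps_sym[THEN iffD1, OF e])
  have mp: "minimal_homeomorphism Y ?\<psi>"
    using minimal_homeomorphism_conjugate[OF e \<phi>(1)] .
  have c\<phi>: "continuous_map X X \<phi>" and c\<psi>: "continuous_map Y Y ?\<psi>"
    using \<phi>(1) mp homeomorphic_imp_continuous_map by (auto simp: minimal_homeomorphism_def)
  have "\<nu> \<in> push Y e ` K" if \<nu>: "\<nu> \<in> invariant_measures Y ?\<psi>" for \<nu>
  proof -
    have nb: "\<nu> \<in> borel_prob_measures Y" using \<nu> invariant_measures_subset by blast
    have "push X d \<nu> \<in> invariant_measures X (d \<circ> ?\<psi> \<circ> e)"
      using invariant_measures_conjugate[OF d c\<psi> \<nu>] .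
    \<comment> \<open>The two maps agree only on \<open>topspace X\<close>, hence an argument by
      congruence of image measures instead of equality of maps.\<close>
    moreover have "push X (d \<circ> ?\<psi> \<circ> e) (push X d \<nu>) = push X \<phi> (push X d \<nu>)"
      unfolding push_def
    proof (rule distr_cong)
      fix x assume "x \<in> space (distr \<nu> (borel_of_top X) d)"
      then have x: "x \<in> topspace X" by simp
      then have "\<phi> x \<in> topspace X" using c\<phi> by (auto simp: continuous_map_def)
      then show "(d \<circ> ?\<psi> \<circ> e) x = \<phi> x" using x e by (simp add: homeomorphic_maps_def)
    qed auto
    ultimately have "push X d \<nu> \<in> K"
      by (simp add: \<phi>(2) invariant_measures_def pushforward_eq_push)
    then show ?thesis using push_inverse[OF d nb] by force
  qed
  moreover have "push Y e \<mu> \<in> invariant_measures Y ?\<psi>" if "\<mu> \<in> K" for \<mu>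
    using invariant_measures_conjugate[OF e c\<phi>] that \<phi>(2) by blast
  ultimately have "push Y e ` K = invariant_measures Y ?\<psi>" by blast
  then show ?thesis using mp by (auto simp: dynamical_simplex_def)
qed

section \<open>An invariant of sets of measures\<close>

definition has_strict_maximum :: "'a topology \<Rightarrow> 'a measure set \<Rightarrow> bool" where
  "has_strict_maximum X K \<longleftrightarrow>
     (\<exists>A\<in>clopens X. \<exists>\<nu>\<in>K. \<forall>\<mu>\<in>K. \<mu> \<noteq> \<nu> \<longrightarrow> measure \<mu> A < measure \<nu> A)"

text \<open>The witness is pulled back to its preimage, and strictness survives since
  \<open>push\<close> along a homeomorphism is injective. The opposite direction results from
  applying this to the inverse.\<close>

lemma has_strict_maximum_push:
  assumes e: "homeomorphic_maps X Y e d" and K: "K \<subseteq> borel_prob_measures X"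
    and max: "has_strict_maximum Y (push Y e ` K)"
  shows "has_strict_maximum X K"
proof -
  obtain A \<nu> where A: "A \<in> clopens Y" and \<nu>: "\<nu> \<in> K"
    and m: "\<And>\<mu>. \<mu> \<in> K \<Longrightarrow> push Y e \<mu> \<noteq> push Y e \<nu> \<Longrightarrow> measure (push Y e \<mu>) A < measure (push Y e \<nu>) A"
    using max unfolding has_strict_maximum_def by blast
  have ce: "continuous_map X Y e" using e by (simp add: homeomorphic_maps_def)
  let ?B = "{x \<in> topspace X. e x \<in> A}"
  have "measure \<mu> ?B < measure \<nu> ?B" if \<mu>: "\<mu> \<in> K" "\<mu> \<noteq> \<nu>" for \<mu>
  proof -
    have b: "\<mu> \<in> borel_prob_measures X" "\<nu> \<in> borel_prob_measures X" using K \<mu> \<nu> by auto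
    then have "push Y e \<mu> \<noteq> push Y e \<nu>"
      using push_inverse[OF e] \<mu>(2) by metis
    then show ?thesis
      using m[OF \<mu>(1)] measure_push[OF ce _ clopens_in_borel[OF A]] b by metis
  qed
  then show ?thesis
    unfolding has_strict_maximum_def using \<nu> clopens_vimage[OF ce A] by blast
qed


text \<open>Made for the shift: what happens on leaving the top of a tower of level \<open>n\<close>
  is visible only at level \<open>n + 1\<close>.\<close>

lemma continuous_map_seq_top_lookahead:
  assumes "\<And>x. x \<in> S \<Longrightarrow> f x \<in> T" and F: "\<And>x n. x \<in> S \<Longrightarrow> f x n = F n (x (Suc n))"
  shows "continuous_map (seq_top S) (seq_top T) f"
  unfolding continuous_map_def
proof (intro conjI allI impI)
  show "f \<in> topspace (seq_top S) \<rightarrow> topspace (seq_top T)" using assms(1) by auto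
  fix U assume U: "openin (seq_top T) U"
  show "openin (seq_top S) {x \<in> topspace (seq_top S). f x \<in> U}"
    unfolding openin_seq_top
  proof (intro conjI ballI)
    fix x assume "x \<in> {x \<in> topspace (seq_top S). f x \<in> U}"
    then have x: "x \<in> S" "f x \<in> U" by auto
    obtain n where n: "\<forall>y\<in>T. (\<forall>i<n. y i = f x i) \<longrightarrow> y \<in> U"
      using openin_seq_topD[OF U x(2)] .
    have "f y \<in> U" if y: "y \<in> S" "\<forall>i<Suc n. y i = x i" for y
      using y assms(1)[OF y(1)] F[OF y(1)] F[OF x(1)] by (intro n[rule_format]) auto
    then show "\<exists>n. \<forall>y\<in>S. (\<forall>i<n. y i = x i) \<longrightarrow> y \<in> {x \<in> topspace (seq_top S). f x \<in> U}"
      by (intro exI[of _ "Suc n"]) simp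
  qed auto
qed

section \<open>An odometer with vertex labels\<close>

text \<open>A word contains two listings of length \<open>2 ^ n\<close>, which is exactly the
  fraction \<open>1 / (n + 2)^2\<close> of its length.\<close>

definition width :: "nat \<Rightarrow> nat" where "width n = 2 ^ Suc n * (n + 2)\<^sup>2"

primrec height :: "nat \<Rightarrow> nat" where
  "height 0 = 1"
| "height (Suc n) = height n * width n"

lemma width_ge: "2 * 2 ^ n \<le> width n"
  by (simp add: width_def)

lemma width_pos [simp]: "0 < width n"
  by (simp add: width_def)

lemma height_pos [simp]: "0 < height n"
  by (induction n) auto

lemma dvd_width: "2 ^ n dvd width n"
  by (simp add: width_def)

text \<open>The wrap-around from the top to the bottom of the same tower is a placeholder, as the
  tower entered next is not known at this level. Its projection one level down is nevertheless
  correct, because all words begin alike and end alike.\<close>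

definition succ_pos :: "nat \<Rightarrow> nat \<times> nat \<Rightarrow> nat \<times> nat" where
  "succ_pos n z = ((fst z + 1) mod height n, snd z)"

definition pred_pos :: "nat \<Rightarrow> nat \<times> nat \<Rightarrow> nat \<times> nat" where
  "pred_pos n z = ((fst z + (height n - 1)) mod height n, snd z)"

lemma pred_succ_pos:
  assumes "fst z < height n" shows "pred_pos n (succ_pos n z) = z"
proof -
  have "((fst z + 1) mod height n + (height n - 1)) mod height n = (fst z + 1 + (height n - 1)) mod height n"
    by (rule mod_add_left_eq)
  also have "fst z + 1 + (height n - 1) = fst z + height n"
    using height_pos[of n] by linarith
  finally have "((fst z + 1) mod height n + (height n - 1)) mod height n = (fst z + height n) mod height n" .
  then show ?thesis
    using assms by (simp add: pred_pos_def succ_pos_def prod_eq_iff)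
qed

lemma succ_pred_pos:
  assumes "fst z < height n" shows "succ_pos n (pred_pos n z) = z"
proof -
  have "((fst z + (height n - 1)) mod height n + 1) mod height n = (fst z + (height n - 1) + 1) mod height n"
    by (rule mod_add_left_eq)
  also have "fst z + (height n - 1) + 1 = fst z + height n"
    using height_pos[of n] by linarith
  finally show ?thesis
    using assms by (simp add: pred_pos_def succ_pos_def prod_eq_iff)
qed

text \<open>The towers of level \<open>n\<close> are labelled by the residues modulo \<open>2 ^ n\<close> fixed by \<open>q\<close>.  The inverse
  limit of these label sets is a closed set of 2-adic integers, with dense subset the fixed points
  of \<open>q\<close>; it parametrizes the ergodic measures.\<close>

locale label_retraction =
  fixes q :: "nat \<Rightarrow> nat"
  assumes idem [simp]: "q (q i) = q i"
    and mod_compat: "q i mod 2 ^ n = q (i mod 2 ^ n)"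
begin

lemma q_0 [simp]: "q 0 = 0"
  using mod_compat[of 0 0] by simp

lemma q_less: "i < 2 ^ n \<Longrightarrow> q i < 2 ^ n"
  using mod_compat[of i n] mod_less_divisor[of "2 ^ n" "q i"] by simp

definition labels :: "nat \<Rightarrow> nat set" where
  "labels n = {v. v < 2 ^ n \<and> q v = v}"

lemma q_mem_labels: "i < 2 ^ n \<Longrightarrow> q i \<in> labels n"
  by (simp add: labels_def q_less)

lemma mod_mem_labels: "q v = v \<Longrightarrow> v mod 2 ^ n \<in> labels n"
  using mod_compat[of v n] by (simp add: labels_def)

lemma zero_mem_labels [simp]: "0 \<in> labels n"
  by (simp add: labels_def)

lemma finite_labels [simp]: "finite (labels n)"
  by (rule finite_subset[of _ "{..<2 ^ n}"]) (auto simp: labels_def)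

text \<open>The outer blocks list the labels \<open>q i\<close> in the same order for every
  \<open>w\<close>. In the last block \<open>i mod 2 ^ n\<close> again runs from 0 to
  \<open>2 ^ n - 1\<close>, since that block starts at a multiple of \<open>2 ^ n\<close>.\<close>

definition word :: "nat \<Rightarrow> nat \<Rightarrow> nat \<Rightarrow> nat" where
  "word n w i = (if i < 2 ^ n \<or> width n - 2 ^ n \<le> i then q (i mod 2 ^ n) else w mod 2 ^ n)"

definition floors :: "nat \<Rightarrow> (nat \<times> nat) set" where
  "floors n = {..<height n} \<times> labels n"

definition proj :: "nat \<Rightarrow> nat \<times> nat \<Rightarrow> nat \<times> nat" where
  "proj n z = (fst z mod height n, word n (snd z) (fst z div height n))"

text \<open>A point is coded by the nested sequence of floors containing it: \<open>proj\<close>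
  sends a floor of level \<open>n + 1\<close> to the floor of level \<open>n\<close> that it was cut
  from.\<close>

definition points :: "(nat \<Rightarrow> nat \<times> nat) set" where
  "points = {x. \<forall>n. x n \<in> floors n \<and> proj n (x (Suc n)) = x n}"

lemma word_mem_labels: "w \<in> labels m \<Longrightarrow> word n w i \<in> labels n"
  unfolding word_def using q_mem_labels[of "i mod 2 ^ n" n] mod_mem_labels[of w n]
  by (auto simp: labels_def)

lemma proj_mem_floors: "z \<in> floors m \<Longrightarrow> proj n z \<in> floors n"
  by (auto simp: proj_def floors_def mem_Times_iff intro: word_mem_labels)

lemma finite_floors [simp]: "finite (floors n)"
  by (simp add: floors_def)

lemma floorsD: "z \<in> floors n \<Longrightarrow> fst z < height n" "z \<in> floors n \<Longrightarrow> snd z \<in> labels n"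
  by (simp_all add: floors_def mem_Times_iff)

lemma succ_pos_mem_floors: "z \<in> floors n \<Longrightarrow> succ_pos n z \<in> floors n"
  and pred_pos_mem_floors: "z \<in> floors n \<Longrightarrow> pred_pos n z \<in> floors n"
  by (simp_all add: floors_def succ_pos_def pred_pos_def mem_Times_iff)

lemma pointsD: "x \<in> points \<Longrightarrow> x n \<in> floors n" "x \<in> points \<Longrightarrow> proj n (x (Suc n)) = x n"
  by (simp_all add: points_def)

subsection \<open>Points through a given floor\<close>

text \<open>Every label occurs in the initial segment of every word, hence every floor of level \<open>n\<close>
  is the projection of a floor of any prescribed tower of level \<open>n + 1\<close>.\<close>

definition lift_pos :: "nat \<Rightarrow> nat \<times> nat \<Rightarrow> nat" where
  "lift_pos n z = fst z + snd z * height n"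

lemma
  assumes "z \<in> floors n"
  shows lift_pos_less: "lift_pos n z < height (Suc n)"
    and proj_lift: "proj n (lift_pos n z, w) = z"
proof -
  have z: "fst z < height n" "snd z < 2 ^ n" "q (snd z) = snd z"
    using assms by (auto simp: floors_def labels_def)
  have "lift_pos n z < (snd z + 1) * height n"
    using z by (simp add: lift_pos_def)
  also have "\<dots> \<le> width n * height n"
    using z(2) width_ge[of n] by (intro mult_right_mono) auto
  finally show "lift_pos n z < height (Suc n)"
    by (simp add: mult.commute)
  have "lift_pos n z mod height n = fst z" "lift_pos n z div height n = snd z"
    using z by (auto simp: lift_pos_def)
  then show "proj n (lift_pos n z, w) = z"
    using z by (simp add: proj_def word_def prod_eq_iff)
qed

primrec climb :: "nat \<Rightarrow> nat \<times> nat \<Rightarrow> nat \<Rightarrow> nat \<times> nat" where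
  "climb n z 0 = z"
| "climb n z (Suc k) = (lift_pos (n + k) (climb n z k), 0)"

primrec descend :: "nat \<Rightarrow> nat \<Rightarrow> nat \<times> nat \<Rightarrow> nat \<times> nat" where
  "descend m 0 z = z"
| "descend m (Suc k) z = descend m k (proj (m + k) z)"

lemma descend_Suc: "descend m (Suc k) z = proj m (descend (Suc m) k z)"
  by (induction k arbitrary: z) auto

lemma climb_mem: "z \<in> floors n \<Longrightarrow> climb n z k \<in> floors (n + k)"
  by (induction k) (auto simp: floors_def[of "Suc _"] lift_pos_less simp del: height.simps)

lemma proj_climb: "z \<in> floors n \<Longrightarrow> proj (n + k) (climb n z (Suc k)) = climb n z k"
  by (simp add: proj_lift climb_mem)

lemma descend_mem: "z \<in> floors (m + k) \<Longrightarrow> descend m k z \<in> floors m"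
  by (induction k arbitrary: z) (auto simp: proj_mem_floors)

lemma descend_climb: "z \<in> floors n \<Longrightarrow> descend n k (climb n z k) = z"
  by (induction k) (simp_all add: proj_climb del: climb.simps(2))

lemma point_through:
  assumes "z \<in> floors n"
  obtains x where "x \<in> points" "x n = z"
proof
  \<comment> \<open>Climbing \<open>m\<close> levels above \<open>n\<close> and then descending
    \<open>n\<close> levels ends at level \<open>m\<close>; one formula serves the levels below and
    above \<open>n\<close>.\<close>
  define x where "x m = descend m n (climb n z m)" for m
  have "x m \<in> floors m" for m
    unfolding x_def using climb_mem[OF assms, of m] by (intro descend_mem) (simp add: add.commute)
  moreover have "proj m (x (Suc m)) = x m" for m
  proof -
    have "proj m (x (Suc m)) = descend m (Suc n) (climb n z (Suc m))"
      by (simp add: x_def descend_Suc del: climb.simps descend.simps)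
    also have "\<dots> = descend m n (climb n z m)"
      using proj_climb[OF assms, of m] by (simp add: add.commute del: climb.simps)
    finally show ?thesis by (simp add: x_def)
  qed
  ultimately show "x \<in> points" by (simp add: points_def)
  show "x n = z"
    unfolding x_def using descend_climb[OF assms] .
qed

lemma points_eq_below:
  assumes "x \<in> points" "y \<in> points" "x (n + k) = y (n + k)"
  shows "x n = y n"
  using assms(3)
proof (induction k)
  case (Suc k)
  then show ?case
    using pointsD(2)[OF assms(1), of "n + k"] pointsD(2)[OF assms(2), of "n + k"] by simp
qed simp

abbreviation tower_space where "tower_space \<equiv> seq_top points"

lemma stone_space_tower_space: "stone_space tower_space"
proof (rule stone_space_seq_top[of floors])
  show "x n \<in> floors n" if "x \<in> points" for x n
    using pointsD(1)[OF that] .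
  fix x :: "nat \<Rightarrow> nat \<times> nat"
  assume a: "\<And>n. \<exists>y\<in>points. \<forall>i<n. y i = x i"
  show "x \<in> points"
    unfolding points_def
  proof (intro CollectI allI)
    fix n
    obtain y where "y \<in> points" "\<forall>i<Suc (Suc n). y i = x i" using a by blast
    then show "x n \<in> floors n \<and> proj n (x (Suc n)) = x n"
      using pointsD[of y n] by simp
  qed
qed simp

lemma points_nonempty: "points \<noteq> {}"
proof -
  have "(0, 0) \<in> floors 0" by (simp add: floors_def)
  then show ?thesis using point_through by blast
qed

subsection \<open>The minimal homeomorphism\<close>

definition step :: "(nat \<Rightarrow> nat \<times> nat) \<Rightarrow> nat \<Rightarrow> nat \<times> nat" where
  "step x n = proj n (succ_pos (Suc n) (x (Suc n)))"

definition unstep :: "(nat \<Rightarrow> nat \<times> nat) \<Rightarrow> nat \<Rightarrow> nat \<times> nat" where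
  "unstep x n = proj n (pred_pos (Suc n) (x (Suc n)))"

lemma proj_first: "proj n (0, w) = (0, 0)"
  by (simp add: proj_def word_def)

lemma proj_last: "proj n (height (Suc n) - 1, w) = proj n (height (Suc n) - 1, w')"
proof -
  have "(height (Suc n) - 1) div height n = width n - 1"
  proof (rule div_nat_eqI)
    have "height n * (width n - 1) + height n = height n * (width n - 1 + 1)"
      by (simp only: distrib_left mult_1_right)
    also have "\<dots> = height (Suc n)"
      using width_pos[of n] by simp
    finally have "height n * (width n - 1) + height n = height (Suc n)" .
    then show "height n * (width n - 1) \<le> height (Suc n) - 1"
      using height_pos[of n] by linarith
    show "height (Suc n) - 1 < height n * Suc (width n - 1)"
      using height_pos[of "Suc n"] by simp
  qed
  moreover have "word n w (width n - 1) = word n w' (width n - 1)"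
    by (auto simp: word_def diff_le_mono2 Suc_leI)
  ultimately show ?thesis by (simp add: proj_def)
qed

text \<open>The two sides can differ only in the label of level \<open>n + 1\<close>, and only when the shift leaves
  the tower of level \<open>n + 1\<close>; then all words of level \<open>n\<close> have the same letter there.\<close>

lemma proj_succ_pos:
  assumes "z \<in> floors (Suc (Suc n))"
  shows "proj n (succ_pos (Suc n) (proj (Suc n) z)) = proj n (proj (Suc n) (succ_pos (Suc (Suc n)) z))"
proof -
  let ?h = "height (Suc n)" and ?H = "height (Suc (Suc n))"
  obtain j w where z: "z = (j, w)" "j < ?H"
    using assms by (cases z) (auto simp: floors_def)
  have J: "(j + 1) mod ?H mod ?h = (j + 1) mod ?h"
    by (rule mod_mod_cancel) simp
  have L: "succ_pos (Suc n) (proj (Suc n) z) = ((j + 1) mod ?h, word (Suc n) w (j div ?h))"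
    by (simp add: succ_pos_def proj_def z mod_Suc_eq del: height.simps)
  have R: "proj (Suc n) (succ_pos (Suc (Suc n)) z) = ((j + 1) mod ?h, word (Suc n) w ((j + 1) mod ?H div ?h))"
    using J by (simp add: succ_pos_def proj_def z del: height.simps)
  show ?thesis
  proof (cases "(j + 1) mod ?h = 0")
    case True
    then show ?thesis unfolding L R by (simp add: proj_first)
  next
    case False
    have "j + 1 \<noteq> ?H" using False by (auto simp del: height.simps simp: height.simps(2)[of "Suc n"])
    then have "(j + 1) mod ?H = j + 1" using z(2) by simp
    moreover have "(j + 1) div ?h = j div ?h"
      using False by (simp add: div_Suc del: height.simps)
    ultimately show ?thesis unfolding L R by simp
  qed
qed

lemma proj_pred_pos:
  assumes "z \<in> floors (Suc (Suc n))"
  shows "proj n (pred_pos (Suc n) (proj (Suc n) z)) = proj n (proj (Suc n) (pred_pos (Suc (Suc n)) z))"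
proof -
  let ?h = "height (Suc n)" and ?H = "height (Suc (Suc n))"
  obtain j w where z: "z = (j, w)" "j < ?H"
    using assms by (cases z) (auto simp: floors_def)
  have hH: "?h dvd ?H" "0 < ?h" "0 < ?H" by simp_all
  \<comment> \<open>Adding the modulus minus one subtracts one without truncation, and since
    \<open>?H\<close> is a multiple of \<open>?h\<close> both moduli subtract the same unit.\<close>
  have J: "(j + (?H - 1)) mod ?H mod ?h = (j mod ?h + (?h - 1)) mod ?h"
  proof -
    have "(j + (?H - 1)) mod ?H mod ?h = (j + (?H - 1)) mod ?h"
      using hH(1) by (rule mod_mod_cancel)
    also have "\<dots> = (j + (?h - 1)) mod ?h"
    proof -
      obtain k where k: "?H = ?h * k" using hH(1) by (elim dvdE)
      have "k \<noteq> 0"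
      proof
        assume "k = 0"
        then have "?H = 0" using k by (simp only: mult_0_right)
        then show False using hH(3) by linarith
      qed
      then obtain l where "k = Suc l" by (cases k) simp_all
      then have "?H = ?h + l * ?h" using k by (simp only: mult_Suc mult.commute)
      then have "j + (?H - 1) = j + (?h - 1) + l * ?h" using hH(2) by linarith
      then show ?thesis by (simp only: mod_mult_self1)
    qed
    finally show ?thesis by (simp add: mod_add_left_eq del: height.simps)
  qed
  have L: "pred_pos (Suc n) (proj (Suc n) z) = ((j mod ?h + (?h - 1)) mod ?h, word (Suc n) w (j div ?h))"
    by (simp add: pred_pos_def proj_def z del: height.simps)
  have R: "proj (Suc n) (pred_pos (Suc (Suc n)) z) =
      ((j mod ?h + (?h - 1)) mod ?h, word (Suc n) w ((j + (?H - 1)) mod ?H div ?h))"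
    using J by (simp add: pred_pos_def proj_def z del: height.simps)
  show ?thesis
  proof (cases "j mod ?h = 0")
    case True
    then have e: "(j mod ?h + (?h - 1)) mod ?h = ?h - 1"
      using hH(2) by (simp del: height.simps)
    show ?thesis unfolding L R e by (rule proj_last)
  next
    case False
    then have "0 < j" by (intro gr0I notI) simp
    then have e: "j + (?H - 1) = (j - 1) + ?H" using hH(3) by linarith
    have "j - 1 < ?H" using z(2) by linarith
    then have "(j + (?H - 1)) mod ?H = j - 1" unfolding e by (simp only: mod_add_self2 mod_less)
    moreover have "(j - 1) div ?h = j div ?h"
    proof -
      obtain i where i: "j = Suc i" using \<open>0 < j\<close> by (cases j) simp_all
      have "Suc i div ?h = i div ?h"
        unfolding div_Suc using False by (simp only: i if_False)
      then show ?thesis unfolding i by (simp only: diff_Suc_1)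
    qed
    ultimately show ?thesis unfolding L R by simp
  qed
qed

lemma step_mem: "x \<in> points \<Longrightarrow> step x \<in> points"
  unfolding points_def
proof (intro CollectI allI conjI)
  fix n assume "x \<in> {x. \<forall>n. x n \<in> floors n \<and> proj n (x (Suc n)) = x n}"
  then have x: "x \<in> points" by (simp add: points_def)
  show "step x n \<in> floors n"
    unfolding step_def by (rule proj_mem_floors[OF succ_pos_mem_floors[OF pointsD(1)[OF x]]])
  show "proj n (step x (Suc n)) = step x n"
    using proj_succ_pos[OF pointsD(1)[OF x, of "Suc (Suc n)"], symmetric]
    by (simp only: step_def pointsD(2)[OF x])
qed

lemma unstep_mem: "x \<in> points \<Longrightarrow> unstep x \<in> points"
  unfolding points_def
proof (intro CollectI allI conjI)
  fix n assume "x \<in> {x. \<forall>n. x n \<in> floors n \<and> proj n (x (Suc n)) = x n}"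
  then have x: "x \<in> points" by (simp add: points_def)
  show "unstep x n \<in> floors n"
    unfolding unstep_def by (rule proj_mem_floors[OF pred_pos_mem_floors[OF pointsD(1)[OF x]]])
  show "proj n (unstep x (Suc n)) = unstep x n"
    using proj_pred_pos[OF pointsD(1)[OF x, of "Suc (Suc n)"], symmetric]
    by (simp only: unstep_def pointsD(2)[OF x])
qed

text \<open>Two successive shifts look two levels ahead, so the identity is checked on floors of
  level \<open>n + 2\<close>, where \<open>succ_pos\<close> and \<open>pred_pos\<close> are
  inverse.\<close>

lemma unstep_step: "x \<in> points \<Longrightarrow> unstep (step x) = x"
proof
  fix n assume x: "x \<in> points"
  let ?z = "succ_pos (Suc (Suc n)) (x (Suc (Suc n)))"
  have z: "?z \<in> floors (Suc (Suc n))"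
    using succ_pos_mem_floors[OF pointsD(1)[OF x]] .
  have "unstep (step x) n = proj n (proj (Suc n) (pred_pos (Suc (Suc n)) ?z))"
    unfolding unstep_def step_def using proj_pred_pos[OF z] .
  then show "unstep (step x) n = x n"
    using pred_succ_pos[OF floorsD(1)[OF pointsD(1)[OF x]]] by (simp add: pointsD(2)[OF x])
qed

lemma step_unstep: "x \<in> points \<Longrightarrow> step (unstep x) = x"
proof
  fix n assume x: "x \<in> points"
  let ?z = "pred_pos (Suc (Suc n)) (x (Suc (Suc n)))"
  have z: "?z \<in> floors (Suc (Suc n))"
    using pred_pos_mem_floors[OF pointsD(1)[OF x]] .
  have "step (unstep x) n = proj n (proj (Suc n) (succ_pos (Suc (Suc n)) ?z))"
    unfolding unstep_def step_def using proj_succ_pos[OF z] .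
  then show "step (unstep x) n = x n"
    using succ_pred_pos[OF floorsD(1)[OF pointsD(1)[OF x]]] by (simp add: pointsD(2)[OF x])
qed

lemma step_homeomorphic: "homeomorphic_maps tower_space tower_space step unstep"
  unfolding homeomorphic_maps_def
proof (intro conjI ballI)
  show "continuous_map tower_space tower_space step"
    by (rule continuous_map_seq_top_lookahead[where F = "\<lambda>n z. proj n (succ_pos (Suc n) z)"])
       (simp_all only: step_mem step_def)
  show "continuous_map tower_space tower_space unstep"
    by (rule continuous_map_seq_top_lookahead[where F = "\<lambda>n z. proj n (pred_pos (Suc n) z)"])
       (simp_all only: unstep_mem unstep_def)
qed (simp_all add: unstep_step step_unstep)

lemma step_same_tower:
  assumes x: "x \<in> points" and j: "fst (x n) + 1 < height n"
  shows "step x n = (fst (x n) + 1, snd (x n))"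
proof -
  obtain J w where z: "x (Suc n) = (J, w)" "J < height (Suc n)"
    using pointsD(1)[OF x, of "Suc n"] by (cases "x (Suc n)") (auto simp: floors_def)
  have xn: "x n = (J mod height n, word n w (J div height n))"
    using pointsD(2)[OF x, of n] by (simp add: z proj_def)
  have J1: "(J + 1) mod height n = J mod height n + 1"
    using j xn by (simp add: mod_Suc)
  moreover have "(J + 1) div height n = J div height n"
    using j xn by (simp add: div_Suc mod_Suc)
  moreover have "J + 1 \<noteq> height (Suc n)" using J1 by auto
  then have "(J + 1) mod height (Suc n) = J + 1" using z(2) by simp
  ultimately show ?thesis
    by (simp add: step_def succ_pos_def proj_def z xn del: height.simps)
qed

lemma step_iterate:
  assumes x: "x \<in> points" and j: "fst (x n) + k < height n"
  shows "(step ^^ k) x \<in> points \<and> (step ^^ k) x n = (fst (x n) + k, snd (x n))"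
  using j
proof (induction k)
  case 0
  then show ?case using x by simp
next
  case (Suc k)
  then have "(step ^^ k) x \<in> points" "(step ^^ k) x n = (fst (x n) + k, snd (x n))" by auto
  then show ?case using step_same_tower[of "(step ^^ k) x" n] Suc.prems step_mem by auto
qed

lemma unstep_iterate:
  assumes x: "x \<in> points"
  shows "(unstep ^^ k) x \<in> points \<and> (step ^^ k) ((unstep ^^ k) x) = x"
proof (induction k)
  case 0
  then show ?case using x by simp
next
  case (Suc k)
  have "(step ^^ Suc k) ((unstep ^^ Suc k) x) = (step ^^ k) (step (unstep ((unstep ^^ k) x)))"
    by (simp add: funpow_swap1)
  then show ?case using Suc step_unstep unstep_mem by simp
qed

lemma unstep_same_tower:
  assumes x: "x \<in> points" and j: "0 < fst (x n)"
  shows "unstep x n = (fst (x n) - 1, snd (x n))"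
proof -
  obtain J w where z: "x (Suc n) = (J, w)" "J < height (Suc n)"
    using pointsD(1)[OF x, of "Suc n"] by (cases "x (Suc n)") (auto simp: floors_def)
  have xn: "x n = (J mod height n, word n w (J div height n))"
    using pointsD(2)[OF x, of n] by (simp add: z proj_def)
  then have "J mod height n \<noteq> 0" using j by simp
  then have "0 < J" by (intro gr0I notI) simp
  then obtain I where I: "J = Suc I" by (cases J) simp_all
  have "Suc I mod height n \<noteq> 0" using \<open>J mod height n \<noteq> 0\<close> I by simp
  then have "I mod height n = J mod height n - 1" "I div height n = J div height n"
    unfolding I by (auto simp: mod_Suc div_Suc split: if_splits)
  moreover have "(J + (height (Suc n) - 1)) mod height (Suc n) = I"
  proof -
    have e: "J + (height (Suc n) - 1) = I + height (Suc n)"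
      using I height_pos[of "Suc n"] by linarith
    have "I < height (Suc n)" using z(2) I by linarith
    then show ?thesis unfolding e by (simp only: mod_add_self2 mod_less)
  qed
  ultimately show ?thesis
    by (simp add: unstep_def pred_pos_def proj_def z xn del: height.simps)
qed

lemma unstep_iterate_tower:
  assumes x: "x \<in> points" and j: "k \<le> fst (x n)"
  shows "(unstep ^^ k) x n = (fst (x n) - k, snd (x n))"
  using j
proof (induction k)
  case (Suc k)
  then show ?case
    using unstep_same_tower[of "(unstep ^^ k) x" n] unstep_iterate[OF x] by simp
qed simp

text \<open>An open set around \<open>y\<close> contains all points through the floor
  \<open>y n\<close> for some \<open>n\<close>. Every tower of level \<open>n + 1\<close> passes
  through that floor at position \<open>lift_pos n (y n)\<close>, whatever its label. So
  \<open>x\<close> reaches it inside its own tower, moving up or down.\<close>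

lemma minimal_step: "minimal_homeomorphism tower_space step"
  unfolding minimal_homeomorphism_def
proof (intro conjI ballI)
  show "homeomorphic_map tower_space tower_space step"
    by (rule homeomorphic_maps_imp_map[OF step_homeomorphic])
  fix x assume "x \<in> topspace tower_space"
  then have x: "x \<in> points" by simp
  have "\<exists>y. y \<in> two_sided_orbit tower_space step x \<and> y \<in> U" if y: "y \<in> U" and U: "openin tower_space U" for y U
  proof -
    have yp: "y \<in> points" using openin_subset[OF U] y by auto
    obtain n where n: "\<forall>z\<in>points. (\<forall>i<n. z i = y i) \<longrightarrow> z \<in> U"
      using openin_seq_topD[OF U y] .
    have near: "z \<in> U" if "z \<in> points" "z n = y n" for z
    proof (rule n[rule_format])
      fix i assume "i < n"
      then show "z i = y i"
        using points_eq_below[OF that(1) yp, of i "n - i"] that(2) by simp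
    qed (rule that(1))
    let ?j = "lift_pos n (y n)" and ?i = "fst (x (Suc n))"
    have j: "?j < height (Suc n)" by (rule lift_pos_less[OF pointsD(1)[OF yp]])
    have hit: "z \<in> U" if z: "z \<in> points" "z (Suc n) = (?j, w)" for z w
      using near[OF z(1)] pointsD(2)[OF z(1), of n] proj_lift[OF pointsD(1)[OF yp, of n], of w] z(2)
      by simp
    show ?thesis
    proof (cases "?i \<le> ?j")
      case True
      let ?z = "(step ^^ (?j - ?i)) x"
      have z: "?z \<in> points" "?z (Suc n) = (?j, snd (x (Suc n)))"
        using step_iterate[OF x, of "Suc n" "?j - ?i"] True j by (auto simp del: height.simps)
      have "?z \<in> two_sided_orbit tower_space step x"
        by (rule two_sided_orbitI[where n = "?j - ?i"]) (use z in simp_all)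
      then show ?thesis using hit[OF z] by blast
    next
      case False
      let ?z = "(unstep ^^ (?i - ?j)) x"
      have z: "?z \<in> points" "?z (Suc n) = (?j, snd (x (Suc n)))"
        using unstep_iterate[OF x] unstep_iterate_tower[OF x, of "?i - ?j" "Suc n"] False by auto
      have "?z \<in> two_sided_orbit tower_space step x"
        by (rule two_sided_orbitI[where n = "?i - ?j"]) (use z unstep_iterate[OF x] in simp_all)
      then show ?thesis using hit[OF z] by blast
    qed
  qed
  then show "tower_space closure_of two_sided_orbit tower_space step x = topspace tower_space"
    unfolding closure_of_def by auto
qed

end


section \<open>Auxiliary facts on sums and limits\<close>

lemma sum_nat_blocks:
  fixes f :: "nat \<Rightarrow> 'a::comm_monoid_add"
  shows "(\<Sum>j<h * r. f j) = (\<Sum>i<r. \<Sum>j<h. f (j + i * h))"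
proof (induction r)
  case (Suc r)
  have "(\<Sum>j<h * Suc r. f j) = (\<Sum>j<h * r. f j) + (\<Sum>j\<in>{h * r..<h * r + h}. f j)"
    by (simp add: lessThan_atLeast0 sum.atLeastLessThan_concat add.commute)
  also have "(\<Sum>j\<in>{h * r..<h * r + h}. f j) = (\<Sum>j<h. f (j + r * h))"
    using sum.shift_bounds_nat_ivl[of f 0 "h * r" h] by (simp add: lessThan_atLeast0 mult.commute add.commute)
  finally show ?case using Suc by simp
qed simp

lemma le_if_le_inverse_Suc:
  fixes x y :: real
  assumes "\<And>n. m \<le> n \<Longrightarrow> x \<le> y + c / (real n + 1)"
  shows "x \<le> y"
proof (rule LIMSEQ_le_const)
  have "(\<lambda>n. y + c * inverse (real (Suc n))) \<longlonglongrightarrow> y + c * 0"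
    by (intro tendsto_intros LIMSEQ_inverse_real_of_nat)
  then show "(\<lambda>n. y + c / (real n + 1)) \<longlonglongrightarrow> y"
    by (simp add: divide_inverse add.commute)
  show "\<exists>N. \<forall>n\<ge>N. x \<le> y + c / (real n + 1)" using assms by blast
qed

context label_retraction
begin

subsection \<open>Levels of clopen sets\<close>

definition slice :: "nat \<Rightarrow> (nat \<Rightarrow> nat \<times> nat) set \<Rightarrow> (nat \<times> nat) set" where
  "slice n A = (\<lambda>x. x n) ` A"

definition has_level :: "(nat \<Rightarrow> nat \<times> nat) set \<Rightarrow> nat \<Rightarrow> bool" where
  "has_level A n \<longleftrightarrow> A \<subseteq> points \<and> (\<forall>x\<in>A. \<forall>y\<in>points. y n = x n \<longrightarrow> y \<in> A)"

lemma has_level_mono: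
  assumes "has_level A n" "n \<le> m"
  shows "has_level A m"
  unfolding has_level_def
proof (intro conjI ballI impI)
  show "A \<subseteq> points" using assms(1) by (simp add: has_level_def)
  fix x y assume x: "x \<in> A" and y: "y \<in> points" "y m = x m"
  then have "x \<in> points" using \<open>A \<subseteq> points\<close> by (rule_tac subsetD)
  then have "y n = x n"
    using points_eq_below[OF y(1), of x n "m - n"] y(2) assms(2) by simp
  then show "y \<in> A" using assms(1) x y(1) unfolding has_level_def by simp
qed

lemma has_level_subset: "has_level A n \<Longrightarrow> A \<subseteq> points"
  by (simp add: has_level_def)

lemma has_level_mem_iff:
  assumes "has_level A n" "x \<in> points"
  shows "x n \<in> slice n A \<longleftrightarrow> x \<in> A"
proof
  assume "x n \<in> slice n A"
  then obtain y where "y \<in> A" "x n = y n" unfolding slice_def by (elim imageE)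
  then show "x \<in> A" using assms unfolding has_level_def by simp
qed (simp add: slice_def)

lemma has_level_eq: "has_level A n \<Longrightarrow> A = {x \<in> points. x n \<in> slice n A}"
  using has_level_mem_iff[of A n] has_level_subset[of A n] by auto

lemma has_level_clopen:
  assumes "has_level A n" shows "A \<in> clopens tower_space"
  by (subst has_level_eq[OF assms]) (rule seq_top_coordinate)

lemma has_level_Collect: "has_level {x \<in> points. x n \<in> S} n"
  by (simp add: has_level_def)

lemma has_level_Union:
  assumes "finite F" "\<And>A. A \<in> F \<Longrightarrow> \<exists>n. has_level A n"
  shows "\<exists>n. has_level (\<Union>F) n"
  using assms
proof (induction F rule: finite_induct)
  case empty
  show ?case by (simp add: has_level_def)
next
  case (insert A F)
  have "\<exists>n. has_level A n" "\<exists>m. has_level (\<Union>F) m" using insert by simp_all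
  then obtain n m where "has_level A n" "has_level (\<Union>F) m" by (elim exE)
  then have l: "has_level A (max n m)" "has_level (\<Union>F) (max n m)"
    using has_level_mono[of A n "max n m"] has_level_mono[of "\<Union>F" m "max n m"] by simp_all
  have "has_level (A \<union> \<Union>F) (max n m)"
    using l unfolding has_level_def by blast
  then show ?case by auto
qed

text \<open>Compactness reduces a cover by floors to a finite one, and finitely many levels have a
  common upper bound.\<close>

lemma clopen_has_level:
  assumes A: "A \<in> clopens tower_space"
  obtains n where "has_level A n"
proof -
  define \<U> where "\<U> = {C. C \<subseteq> A \<and> (\<exists>n. has_level C n)}"
  have op: "openin tower_space A" using A by (simp add: clopens_def)
  have "A \<subseteq> \<Union>\<U>"
  proof
    fix x assume x: "x \<in> A"
    obtain n where n: "\<forall>y\<in>points. (\<forall>i<n. y i = x i) \<longrightarrow> y \<in> A"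
      using openin_seq_topD[OF op x] .
    have xp: "x \<in> points" using openin_subset[OF op] x by auto
    let ?C = "{y \<in> points. y n \<in> {x n}}"
    have "?C \<subseteq> A"
    proof
      fix y assume y: "y \<in> ?C"
      then have yp: "y \<in> points" "y n = x n" by auto
      show "y \<in> A"
      proof (rule n[rule_format])
        fix i assume "i < n"
        then show "y i = x i"
          using points_eq_below[OF yp(1) xp, of i "n - i"] yp(2) by simp
      qed (rule yp(1))
    qed
    then have "?C \<in> \<U>" unfolding \<U>_def using has_level_Collect by blast
    moreover have "x \<in> ?C" using xp by simp
    ultimately show "x \<in> \<Union>\<U>" by (rule UnionI)
  qed
  moreover have "Ball \<U> (openin tower_space)"
    using has_level_clopen by (auto simp: \<U>_def clopens_def)
  ultimately have "\<exists>F. finite F \<and> F \<subseteq> \<U> \<and> A \<subseteq> \<Union>F"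
    using stone_space_compactin[OF stone_space_tower_space A] unfolding compactin_def by blast
  then obtain F where F: "finite F" "F \<subseteq> \<U>" "A \<subseteq> \<Union>F" by (elim exE conjE)
  have "A = \<Union>F" using F(2,3) unfolding \<U>_def by blast
  moreover have "\<exists>n. has_level (\<Union>F) n"
    using F(1) by (rule has_level_Union) (use F(2) in \<open>auto simp: \<U>_def\<close>)
  ultimately show ?thesis using that by blast
qed

lemma slice_subset: "A \<subseteq> points \<Longrightarrow> slice n A \<subseteq> floors n"
  using pointsD(1) by (auto simp: slice_def)

lemma slice_Collect:
  assumes "S \<subseteq> floors n"
  shows "slice n {x \<in> points. x n \<in> S} = S"
proof (intro equalityI subsetI)
  fix z assume z: "z \<in> S"
  then have "z \<in> floors n" using assms by (rule_tac subsetD)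
  then obtain x where "x \<in> points" "x n = z" by (rule point_through)
  then show "z \<in> slice n {x \<in> points. x n \<in> S}"
    using z unfolding slice_def by (intro image_eqI[of _ _ x]) simp_all
qed (auto simp: slice_def)

lemma slice_points: "slice n points = floors n"
proof -
  have "{x \<in> points. x n \<in> floors n} = points" using pointsD(1) by auto
  then show ?thesis using slice_Collect[of "floors n" n] by simp
qed

lemma slice_Suc:
  assumes A: "has_level A n"
  shows "slice (Suc n) A = {z \<in> floors (Suc n). proj n z \<in> slice n A}"
proof -
  have "A = {x \<in> points. x (Suc n) \<in> {z \<in> floors (Suc n). proj n z \<in> slice n A}}"
    using has_level_mem_iff[OF A] has_level_subset[OF A] pointsD by auto
  then show ?thesis
    using slice_Collect[of "{z \<in> floors (Suc n). proj n z \<in> slice n A}" "Suc n"] by auto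
qed

subsection \<open>Densities in towers\<close>

definition density :: "nat \<Rightarrow> (nat \<times> nat) set \<Rightarrow> nat \<Rightarrow> real" where
  "density n S w = real (card {j. j < height n \<and> (j, w) \<in> S}) / height n"

text \<open>The average runs over residues, so a label counts as often as a listing contains it.
  With these weights averages of successive levels are compatible under reduction.\<close>

definition avg :: "nat \<Rightarrow> (nat \<Rightarrow> real) \<Rightarrow> real" where
  "avg n f = (\<Sum>i<2 ^ n. f (q i)) / 2 ^ n"

lemma density_sum: "density n S w * height n = (\<Sum>j<height n. if (j, w) \<in> S then 1 else 0)"
proof -
  have "(\<Sum>j<height n. if (j, w) \<in> S then 1 else 0 :: real) = real (card {j \<in> {..<height n}. (j, w) \<in> S})"
    by (subst sum.inter_filter[symmetric]) simp_all
  then show ?thesis by (simp add: density_def)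
qed

lemma word_sum:
  fixes g :: "nat \<Rightarrow> real"
  shows "(\<Sum>i<width n. g (word n w i)) = 2 * (\<Sum>i<2 ^ n. g (q i)) + (real (width n) - 2 * 2 ^ n) * g (w mod 2 ^ n)"
proof -
  let ?a = "2 ^ n :: nat" and ?b = "width n - 2 ^ n"
  have ab: "?a \<le> ?b" "?b \<le> width n" using width_ge[of n] by linarith+
  have "(\<Sum>i<width n. g (word n w i)) =
      (\<Sum>i\<in>{0..<?a}. g (word n w i)) + (\<Sum>i\<in>{?a..<?b}. g (word n w i)) + (\<Sum>i\<in>{?b..<width n}. g (word n w i))"
    using ab by (simp add: lessThan_atLeast0 sum.atLeastLessThan_concat)
  also have "(\<Sum>i\<in>{0..<?a}. g (word n w i)) = (\<Sum>i<2 ^ n. g (q i))"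
    unfolding lessThan_atLeast0 by (intro sum.cong) (simp_all add: word_def)
  also have "(\<Sum>i\<in>{?a..<?b}. g (word n w i)) = (\<Sum>i\<in>{?a..<?b}. g (w mod 2 ^ n))"
    by (intro sum.cong) (simp_all add: word_def)
  also have "\<dots> = (real (width n) - 2 * 2 ^ n) * g (w mod 2 ^ n)"
    using ab by (simp add: of_nat_diff)
  also have "(\<Sum>i\<in>{?b..<width n}. g (word n w i)) = (\<Sum>i<2 ^ n. g (q i))"
  proof -
    have e: "width n = 2 ^ n + ?b" using ab by linarith
    have "(\<Sum>i\<in>{?b..<width n}. g (word n w i)) = (\<Sum>i\<in>{0..<2 ^ n}. g (word n w (i + ?b)))"
      using sum.shift_bounds_nat_ivl[of "\<lambda>i. g (word n w i)" 0 ?b "2 ^ n"] e by simp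
    also have "\<dots> = (\<Sum>i\<in>{0..<2 ^ n}. g (q i))"
    proof (rule sum.cong)
      fix i :: nat assume i: "i \<in> {0..<2 ^ n}"
      \<comment> \<open>The closing block starts at a multiple of \<open>2 ^ n\<close>, so it
        repeats the opening block letter by letter.\<close>
      have "2 ^ n dvd ?b" using dvd_width by (simp add: dvd_diff_nat)
      then have "(i + ?b) mod 2 ^ n = i"
        using i by (simp add: mod_add_eq[symmetric, of i ?b] dvd_imp_mod_0)
      then show "g (word n w (i + ?b)) = g (q i)" by (simp add: word_def)
    qed simp
    finally show ?thesis by (simp add: lessThan_atLeast0)
  qed
  finally show ?thesis by simp
qed

text \<open>Out of \<open>2 * 2 ^ n * (n + 2)^2\<close> letters, \<open>2 * 2 ^ n\<close> belong to
  the listings and contribute the average; all others repeat the label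
  \<open>w mod 2 ^ n\<close>.\<close>

lemma density_lift:
  assumes w: "w \<in> labels (Suc n)"
  shows "density (Suc n) {z \<in> floors (Suc n). proj n z \<in> S} w =
    avg n (density n S) / (real n + 2)\<^sup>2 + (1 - 1 / (real n + 2)\<^sup>2) * density n S (w mod 2 ^ n)"
proof -
  let ?T = "{z \<in> floors (Suc n). proj n z \<in> S}"
  let ?c = "\<lambda>z. if z \<in> S then 1 else 0 :: real"
  have "density (Suc n) ?T w * height (Suc n) = (\<Sum>j<height n * width n. if (j, w) \<in> ?T then 1 else 0)"
    using density_sum[of "Suc n" ?T w] by simp
  also have "\<dots> = (\<Sum>j<height n * width n. ?c (proj n (j, w)))"
    using w by (intro sum.cong) (simp_all add: floors_def)
  also have "\<dots> = (\<Sum>i<width n. \<Sum>j<height n. ?c (proj n (j + i * height n, w)))"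
    by (rule sum_nat_blocks)
  also have "\<dots> = (\<Sum>i<width n. \<Sum>j<height n. ?c (j, word n w i))"
    by (intro sum.cong) (simp_all add: proj_def)
  also have "\<dots> = (\<Sum>i<width n. density n S (word n w i) * height n)"
    by (simp only: density_sum)
  also have "\<dots> = height n * (\<Sum>i<width n. density n S (word n w i))"
    by (simp add: sum_distrib_right[symmetric])
  also have "\<dots> = height n * (2 * (\<Sum>i<2 ^ n. density n S (q i)) +
      (real (width n) - 2 * 2 ^ n) * density n S (w mod 2 ^ n))"
    by (simp only: word_sum)
  also have "(\<Sum>i<2 ^ n. density n S (q i)) = 2 ^ n * avg n (density n S)"
    by (simp add: avg_def)
  finally have eq: "density (Suc n) ?T w * (real (height n) * real (width n)) =
      real (height n) * (2 * (2 ^ n * avg n (density n S)) + (real (width n) - 2 * 2 ^ n) * density n S (w mod 2 ^ n))"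
    by simp
  have W: "real (width n) = 2 * 2 ^ n * (real n + 2)\<^sup>2"
    by (simp add: width_def)
  define D where "D = density (Suc n) ?T w"
  define N where "N = (real n + 2)\<^sup>2"
  have N: "N \<noteq> 0" by (simp add: N_def add_nonneg_eq_0_iff)
  have "(real (height n) * (2 * 2 ^ n)) * (D * N) = (real (height n) * (2 * 2 ^ n)) *
      (avg n (density n S) + (N - 1) * density n S (w mod 2 ^ n))"
    using eq unfolding W D_def[symmetric] N_def[symmetric] by (simp add: algebra_simps)
  then have "D * N = avg n (density n S) + (N - 1) * density n S (w mod 2 ^ n)"
    by (subst (asm) mult_cancel_left) (use height_pos[of n] in simp)
  then have "D = avg n (density n S) / N + (1 - 1 / N) * density n S (w mod 2 ^ n)"
    using N by (simp add: field_simps)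
  then show ?thesis by (simp add: D_def N_def)
qed

lemma avg_cong: "(\<And>v. v \<in> labels n \<Longrightarrow> f v = g v) \<Longrightarrow> avg n f = avg n g"
  unfolding avg_def by (intro arg_cong2[where f = "(/)"] sum.cong) (auto intro: q_mem_labels)

lemma avg_const: "avg n (\<lambda>_. c) = c"
  by (simp add: avg_def)

lemma avg_add: "avg n (\<lambda>v. f v + g v) = avg n f + avg n g"
  by (simp add: avg_def sum.distrib add_divide_distrib)

lemma avg_cmult: "avg n (\<lambda>v. c * f v) = c * avg n f"
  by (simp add: avg_def sum_distrib_left[symmetric])

lemma avg_mono: "(\<And>v. f v \<le> g v) \<Longrightarrow> avg n f \<le> avg n g"
  unfolding avg_def by (intro divide_right_mono sum_mono) simp_all

lemma avg_mod: "avg (Suc n) (\<lambda>v. f (v mod 2 ^ n)) = avg n f"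
proof -
  have "(\<Sum>i<2 ^ Suc n. f (q i mod 2 ^ n)) = (\<Sum>i<2 ^ n * 2. f (q (i mod 2 ^ n)))"
    by (simp add: mod_compat mult.commute)
  also have "\<dots> = (\<Sum>i<2. \<Sum>j<2 ^ n. f (q ((j + i * 2 ^ n) mod 2 ^ n)))"
    by (rule sum_nat_blocks)
  also have "\<dots> = (\<Sum>i<(2::nat). \<Sum>j<2 ^ n. f (q j))"
    by (intro sum.cong) simp_all
  finally show ?thesis by (simp add: avg_def)
qed

subsection \<open>The value function\<close>

text \<open>The weights are chosen so that \<open>level_value\<close> does not depend on the level: passing from
  level \<open>n\<close> to \<open>n + 1\<close> mixes densities with weight \<open>1 / (n + 2)\<^sup>2\<close>, and
  \<open>(n + 2) / (n + 3) * (1 - 1 / (n + 2)\<^sup>2) = (n + 1) / (n + 2)\<close>.\<close>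

definition level_value :: "nat \<Rightarrow> (nat \<times> nat) set \<Rightarrow> nat \<Rightarrow> real" where
  "level_value n S k = ((real n + 1) * density n S (q k mod 2 ^ n) + avg n (density n S)) / (real n + 2)"

text \<open>Averaging the recursion of \<open>density_lift\<close> leaves the average fixed. With
  \<open>N = n + 2\<close>, the claim for the values is then the identity
  \<open>N^2 - 1 = (N - 1) * (N + 1)\<close>.\<close>

lemma level_value_lift:
  "level_value (Suc n) {z \<in> floors (Suc n). proj n z \<in> S} k = level_value n S k"
proof -
  let ?T = "{z \<in> floors (Suc n). proj n z \<in> S}"
  define N where "N = real n + 2"
  define a where "a = avg n (density n S)"
  have N: "N > 0" by (simp add: N_def)
  have D: "density (Suc n) ?T w = a / N\<^sup>2 + (1 - 1 / N\<^sup>2) * density n S (w mod 2 ^ n)"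
    if "w \<in> labels (Suc n)" for w
    using density_lift[OF that] by (simp add: N_def a_def)
  have "avg (Suc n) (density (Suc n) ?T) = avg (Suc n) (\<lambda>w. a / N\<^sup>2 + (1 - 1 / N\<^sup>2) * density n S (w mod 2 ^ n))"
    by (rule avg_cong) (rule D)
  also have "\<dots> = a / N\<^sup>2 + (1 - 1 / N\<^sup>2) * a"
    by (simp add: avg_add avg_const avg_cmult avg_mod a_def)
  also have "\<dots> = a" using N by (simp add: field_simps)
  finally have A: "avg (Suc n) (density (Suc n) ?T) = a" .
  have "q k mod 2 ^ Suc n \<in> labels (Suc n)" by (intro mod_mem_labels) simp
  then have "density (Suc n) ?T (q k mod 2 ^ Suc n) = a / N\<^sup>2 + (1 - 1 / N\<^sup>2) * density n S (q k mod 2 ^ n)"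
    using D by (simp add: mod_mod_cancel)
  then have "level_value (Suc n) ?T k = (N * (a / N\<^sup>2 + (1 - 1 / N\<^sup>2) * density n S (q k mod 2 ^ n)) + a) / (N + 1)"
    unfolding level_value_def A by (simp add: N_def add.commute)
  also have "\<dots> = ((N - 1) * density n S (q k mod 2 ^ n) + a) / N"
  proof -
    have "N + 1 \<noteq> 0" "N \<noteq> 0" using N by linarith+
    then show ?thesis by (simp add: divide_simps power2_eq_square) algebra
  qed
  also have "\<dots> = level_value n S k" by (simp add: level_value_def N_def a_def)
  finally show ?thesis .
qed

text \<open>This is the limit of the densities of \<open>A\<close> in the towers labelled
  \<open>q k mod 2 ^ n\<close>. Every level of \<open>A\<close> gives the same number; the least one
  is a canonical choice.\<close>

definition val :: "(nat \<Rightarrow> nat \<times> nat) set \<Rightarrow> nat \<Rightarrow> real" where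
  "val A k = level_value (LEAST n. has_level A n) (slice (LEAST n. has_level A n) A) k"

lemma val_eq:
  assumes "has_level A n"
  shows "val A k = level_value n (slice n A) k"
proof -
  have "level_value (m + i) (slice (m + i) A) k = level_value m (slice m A) k" if m: "has_level A m" for m i
  proof (induction i)
    case (Suc i)
    have l: "has_level A (m + i)" using has_level_mono[OF m, of "m + i"] by simp
    show ?case unfolding add_Suc_right slice_Suc[OF l] level_value_lift by (rule Suc)
  qed simp
  from this[OF LeastI[of "has_level A", OF assms], of "n - (LEAST n. has_level A n)"]
  have "level_value n (slice n A) k =
      level_value (LEAST n. has_level A n) (slice (LEAST n. has_level A n) A) k"
    unfolding le_add_diff_inverse[OF Least_le[of "has_level A", OF assms]] .
  then show ?thesis unfolding val_def by (rule sym)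
qed

lemma val_q: "val A (q k) = val A k"
  by (simp add: val_def level_value_def)

lemma val_mod:
  assumes "has_level A n" shows "val A (k mod 2 ^ n) = val A k"
  unfolding val_eq[OF assms] level_value_def by (simp add: mod_compat)

lemma density_nonneg: "0 \<le> density n S w"
  by (simp add: density_def)

lemma avg_nonneg: "(\<And>v. 0 \<le> f v) \<Longrightarrow> 0 \<le> avg n f"
  unfolding avg_def by (intro divide_nonneg_pos sum_nonneg) simp_all

lemma val_nonneg: "A \<in> clopens tower_space \<Longrightarrow> 0 \<le> val A k"
  by (elim clopen_has_level) (simp add: val_eq level_value_def density_nonneg avg_nonneg)

text \<open>Positivity comes from the average: a single floor in a single tower makes it positive,
  and it enters the value at every parameter.\<close>

lemma val_pos:
  assumes A: "A \<in> clopens tower_space" and ne: "A \<noteq> {}"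
  shows "0 < val A k"
proof -
  obtain n where n: "has_level A n" using clopen_has_level[OF A] .
  obtain x where x: "x \<in> A" using ne by (rule_tac ex_in_conv[THEN iffD2, THEN exE])
  obtain j v where z: "x n = (j, v)" by (cases "x n")
  have "x n \<in> floors n" using has_level_subset[OF n] x pointsD(1) by (rule_tac pointsD(1), rule_tac subsetD)
  then have j: "j < height n" "v < 2 ^ n" "q v = v" using z by (simp_all add: floors_def labels_def)
  have "(j, v) \<in> slice n A" using x z unfolding slice_def by (metis imageI)
  then have "{j'. j' < height n \<and> (j', v) \<in> slice n A} \<noteq> {}" using j by auto
  then have "0 < card {j'. j' < height n \<and> (j', v) \<in> slice n A}"
    by (simp add: card_gt_0_iff del: Collect_empty_eq)
  then have "0 < density n (slice n A) v"
    by (simp add: density_def)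
  then have "0 < (\<Sum>i<2 ^ n. density n (slice n A) (q i))"
    using j by (intro sum_pos2[of _ v]) (simp_all add: density_nonneg)
  then have "0 < avg n (density n (slice n A))" by (simp add: avg_def)
  then show ?thesis
    unfolding val_eq[OF n] level_value_def
    by (intro divide_pos_pos add_nonneg_pos mult_nonneg_nonneg) (simp_all add: density_nonneg)
qed

lemma val_empty [simp]: "val {} k = 0"
proof -
  have "has_level {} 0" by (simp add: has_level_def)
  then show ?thesis by (simp add: val_eq level_value_def density_def slice_def avg_def)
qed

lemma val_points: "val points k = 1"
proof -
  have l: "has_level points 0" by (simp add: has_level_def)
  have "density 0 (floors 0) w = 1" if "w \<in> labels 0" for w
    using that by (simp add: density_def floors_def)
  then show ?thesis
    unfolding val_eq[OF l] slice_points level_value_def by (simp add: avg_def)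
qed

lemma density_Un:
  assumes "S \<inter> T = {}"
  shows "density n (S \<union> T) w = density n S w + density n T w"
proof -
  have "{j. j < height n \<and> (j, w) \<in> S \<union> T} = {j. j < height n \<and> (j, w) \<in> S} \<union> {j. j < height n \<and> (j, w) \<in> T}"
    by auto
  moreover have "{j. j < height n \<and> (j, w) \<in> S} \<inter> {j. j < height n \<and> (j, w) \<in> T} = {}"
    using assms by auto
  ultimately have "card {j. j < height n \<and> (j, w) \<in> S \<union> T} =
      card {j. j < height n \<and> (j, w) \<in> S} + card {j. j < height n \<and> (j, w) \<in> T}"
    by (simp add: card_Un_disjoint)
  then show ?thesis by (simp only: density_def of_nat_add add_divide_distrib)
qed

lemma common_level:
  assumes "A \<in> clopens tower_space" "B \<in> clopens tower_space"
  obtains n where "has_level A n" "has_level B n" "m \<le> n"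
proof -
  obtain i j where ij: "has_level A i" "has_level B j"
    using clopen_has_level[OF assms(1)] clopen_has_level[OF assms(2)] by metis
  show ?thesis
    by (rule that[of "max m (max i j)"]) (use has_level_mono[OF ij(1)] has_level_mono[OF ij(2)] in simp_all)
qed

lemma val_Un:
  assumes "A \<in> clopens tower_space" "B \<in> clopens tower_space" "A \<inter> B = {}"
  shows "val (A \<union> B) k = val A k + val B k"
proof -
  obtain n where n: "has_level A n" "has_level B n" using common_level[OF assms(1,2)] by metis
  have u: "has_level (A \<union> B) n"
    using n unfolding has_level_def by blast
  have d: "slice n A \<inter> slice n B = {}"
  proof (rule ccontr)
    assume "slice n A \<inter> slice n B \<noteq> {}"
    then obtain z where z: "z \<in> slice n A" "z \<in> slice n B" by blast
    obtain x where x: "x \<in> A" "z = x n" using z(1) unfolding slice_def by (elim imageE)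
    have "x \<in> points" using has_level_subset[OF n(1)] x(1) by (rule subsetD)
    then have "x \<in> B" using has_level_mem_iff[OF n(2)] z(2) x(2) by simp
    then show False using x(1) assms(3) by blast
  qed
  have s: "slice n (A \<union> B) = slice n A \<union> slice n B" by (simp add: slice_def image_Un)
  have e: "density n (slice n A \<union> slice n B) = (\<lambda>w. density n (slice n A) w + density n (slice n B) w)"
    using density_Un[OF d] by (intro ext)
  show ?thesis
    unfolding val_eq[OF u] val_eq[OF n(1)] val_eq[OF n(2)] s e level_value_def avg_add
    by (simp add: algebra_simps flip: add_divide_distrib)
qed

lemma val_Diff:
  assumes "A \<in> clopens tower_space" "B \<in> clopens tower_space" "B \<subseteq> A"
  shows "val (A - B) k = val A k - val B k"
  using val_Un[OF clopens_Diff[OF assms(1,2)] assms(2), of k] assms(3)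
  by (simp add: Un_absorb2 Diff_Int_distrib2)

lemma val_le_1:
  assumes "A \<in> clopens tower_space" shows "val A k \<le> 1"
proof -
  have "points \<in> clopens tower_space" using clopens_topspace[of tower_space] by simp
  moreover have "A \<subseteq> points" using clopens_subset[OF assms] by simp
  ultimately show ?thesis
    using val_Diff[of points A k] val_nonneg[OF clopens_Diff[of points tower_space A], of k] assms
    by (simp add: val_points)
qed

lemma val_Rats:
  assumes "A \<in> clopens tower_space" shows "val A k \<in> \<rat>"
proof -
  obtain n where n: "has_level A n" using clopen_has_level[OF assms] .
  have d: "density n (slice n A) v \<in> \<rat>" for v by (simp add: density_def)
  have "(\<Sum>i\<in>I. density n (slice n A) (q i)) \<in> \<rat>" for I
    by (induction I rule: infinite_finite_induct) (simp_all add: d)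
  then show ?thesis unfolding val_eq[OF n] level_value_def avg_def by (simp add: d)
qed

lemma avg_val:
  assumes "has_level A n"
  shows "avg n (val A) = avg n (density n (slice n A))"
proof -
  have "avg n (val A) = avg n (\<lambda>v. (real n + 1) / (real n + 2) * density n (slice n A) v +
      1 / (real n + 2) * avg n (density n (slice n A)))"
  proof (rule avg_cong)
    have lin: "(c * d + a) / N = c / N * d + 1 / N * a" for a c d N :: real
      by (simp add: add_divide_distrib)
    fix v assume "v \<in> labels n"
    then have "q v mod 2 ^ n = v" by (simp add: labels_def)
    then show "val A v = (real n + 1) / (real n + 2) * density n (slice n A) v +
        1 / (real n + 2) * avg n (density n (slice n A))"
      unfolding val_eq[OF assms] level_value_def by (simp only: lin)
  qed
  also have "\<dots> = (real n + 1) / (real n + 2) * avg n (density n (slice n A)) +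
      1 / (real n + 2) * avg n (density n (slice n A))"
    by (simp only: avg_add avg_cmult avg_const)
  also have "\<dots> = ((real n + 1) / (real n + 2) + 1 / (real n + 2)) * avg n (density n (slice n A))"
    by (simp only: distrib_right)
  also have "(real n + 1) / (real n + 2) + 1 / (real n + 2) = 1"
    by (simp add: divide_simps)
  finally show ?thesis by simp
qed

text \<open>The definition of \<open>level_value\<close> is inverted, using that values and
  densities have the same average. Thus the value function alone determines all densities, and with
  them the mass under each invariant measure.\<close>

lemma density_eq_val:
  assumes "has_level A n" "v \<in> labels n"
  shows "density n (slice n A) v = ((real n + 2) * val A v - avg n (val A)) / (real n + 1)"
proof -
  have "val A v = ((real n + 1) * density n (slice n A) v + avg n (val A)) / (real n + 2)"
    using assms(2) by (simp add: val_eq[OF assms(1)] avg_val[OF assms(1)] level_value_def labels_def)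
  then have "(real n + 2) * val A v = (real n + 1) * density n (slice n A) v + avg n (val A)"
    by (simp add: field_simps)
  then show ?thesis by (simp add: field_simps)
qed

lemma density_val_close:
  assumes "has_level A n" "v \<in> labels n"
  shows "\<bar>density n (slice n A) v - val A v\<bar> \<le> 1 / (real n + 1)"
proof -
  have A: "A \<in> clopens tower_space" using has_level_clopen[OF assms(1)] .
  have "density n (slice n A) v - val A v = (val A v - avg n (val A)) / (real n + 1)"
    unfolding density_eq_val[OF assms] by (simp add: field_simps)
  moreover have "0 \<le> avg n (val A)" "avg n (val A) \<le> 1"
    using avg_nonneg[of "val A" n] avg_mono[of "val A" "\<lambda>_. 1" n] val_nonneg[OF A] val_le_1[OF A]
    by (simp_all add: avg_const)
  then have "\<bar>val A v - avg n (val A)\<bar> \<le> 1"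
    using val_nonneg[OF A, of v] val_le_1[OF A, of v] by linarith
  ultimately show ?thesis by (simp add: abs_divide divide_right_mono)
qed

lemma atomless_tower_space: "atomless tower_space"
  unfolding atomless_def
proof (intro ballI impI)
  fix A assume A: "A \<in> clopens tower_space" "A \<noteq> {}"
  obtain n where n: "has_level A n" using clopen_has_level[OF A(1)] .
  obtain x where x: "x \<in> A" using A(2) by (rule_tac ex_in_conv[THEN iffD2, THEN exE])
  have xp: "x \<in> points" using has_level_subset[OF n] x by (rule subsetD)
  text \<open>Every label occurs among the first and again among the last \<open>2 ^ n\<close> letters of a word, so
    each floor of level \<open>n\<close> contains at least two floors of level \<open>n + 1\<close>.\<close>
  let ?j = "fst (x n)" and ?v = "snd (x n)"
  have v: "?v < 2 ^ n" "q ?v = ?v" "?j < height n"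
    using pointsD(1)[OF xp, of n] by (simp_all add: floors_def labels_def mem_Times_iff)
  let ?z1 = "(?j + ?v * height n, 0)" and ?z2 = "(?j + (width n - 2 ^ n + ?v) * height n, 0)"
  have w: "width n - 2 ^ n + ?v < width n" using v(1) width_ge[of n] by linarith
  have lt: "?j + i * height n < height (Suc n)" if "i < width n" for i
  proof -
    have "?j + i * height n < (i + 1) * height n" using v(3) by simp
    also have "\<dots> \<le> width n * height n" using that by (intro mult_right_mono) simp_all
    finally show ?thesis by (simp add: mult.commute)
  qed
  have "?v < width n" using v(1) width_ge[of n] by linarith
  then have f: "?z1 \<in> floors (Suc n)" "?z2 \<in> floors (Suc n)"
    using lt[of ?v] lt[OF w] by (simp_all add: floors_def del: height.simps)
  have mod: "(width n - 2 ^ n + ?v) mod 2 ^ n = ?v"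
  proof -
    have "2 ^ n dvd width n - 2 ^ n" using dvd_width by (simp add: dvd_diff_nat)
    then show ?thesis using v(1) by (simp add: mod_add_left_eq[symmetric] dvd_imp_mod_0)
  qed
  have p: "proj n ?z1 = x n" "proj n ?z2 = x n"
    using v mod by (simp_all add: proj_def word_def prod_eq_iff)
  obtain y1 where y1: "y1 \<in> points" "y1 (Suc n) = ?z1" using point_through[OF f(1)] .
  obtain y2 where y2: "y2 \<in> points" "y2 (Suc n) = ?z2" using point_through[OF f(2)] .
  have "y1 n = x n" "y2 n = x n"
    using pointsD(2)[OF y1(1), of n] pointsD(2)[OF y2(1), of n] y1(2) y2(2) p by simp_all
  then have yA: "y1 \<in> A" "y2 \<in> A" using n x y1(1) y2(1) unfolding has_level_def by simp_all
  let ?B = "A \<inter> {y \<in> points. y (Suc n) \<in> {?z1}}"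
  have "0 < width n - 2 ^ n" using width_ge[of n] zero_less_power[of "2::nat" n] by linarith
  then have "?v < width n - 2 ^ n + ?v" by linarith
  then have "?v * height n < (width n - 2 ^ n + ?v) * height n"
    using height_pos[of n] by (rule mult_strict_right_mono)
  then have "?z1 \<noteq> ?z2" unfolding prod.inject by linarith
  then have "y2 (Suc n) \<noteq> ?z1" unfolding y2(2) by (rule not_sym)
  then have "y2 \<notin> ?B" by blast
  moreover have "y1 \<in> ?B" using yA(1) y1 by blast
  moreover have "?B \<in> clopens tower_space"
    by (intro clopens_Int A(1) seq_top_coordinate)
  ultimately show "\<exists>B\<in>clopens tower_space. B \<subseteq> A \<and> B \<noteq> {} \<and> B \<noteq> A"
    using yA(2) by (intro bexI[of _ ?B] conjI Int_lower1) blast+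
qed


subsection \<open>Prescribing values\<close>

lemma height_dvd: "2 ^ n * (fact (Suc n) * fact (Suc n)) dvd height n"
proof (induction n)
  case (Suc n)
  have "2 ^ Suc n * (fact (Suc (Suc n)) * fact (Suc (Suc n))) =
      (fact (Suc n) * fact (Suc n)) * (2 ^ Suc n * (n + 2)\<^sup>2)"
    by (simp add: power2_eq_square algebra_simps)
  also have "\<dots> dvd (2 ^ n * (fact (Suc n) * fact (Suc n))) * width n"
    unfolding width_def by (intro mult_dvd_mono dvd_triv_right) simp_all
  also have "\<dots> dvd height (Suc n)"
    unfolding height.simps by (intro mult_dvd_mono Suc dvd_refl)
  finally show ?case .
qed simp

text \<open>The factors clear the three denominators met in prescribing values: \<open>2 ^ n\<close>
  from the average, \<open>n + 1\<close> from recovering densities out of values, and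
  \<open>D\<close> from the prescribed function.\<close>

lemma height_dvd': "0 < D \<Longrightarrow> D \<le> Suc n \<Longrightarrow> 2 ^ n * (Suc n * D) dvd height n"
proof -
  assume D: "0 < D" "D \<le> Suc n"
  have "2 ^ n * (Suc n * D) dvd 2 ^ n * (fact (Suc n) * fact (Suc n))"
    using D by (intro mult_dvd_mono dvd_refl dvd_fact) simp_all
  then show ?thesis using height_dvd dvd_trans by metis
qed

lemma common_denominator:
  assumes "finite I" "\<And>i. i \<in> I \<Longrightarrow> f i \<in> \<rat>"
  shows "\<exists>D::nat. 0 < D \<and> (\<forall>i\<in>I. real D * f i \<in> \<int>)"
  using assms
proof (induction I rule: finite_induct)
  case empty
  show ?case by (intro exI[of _ 1]) simp
next
  case (insert i I)
  then obtain D :: nat where D: "0 < D" "\<forall>i\<in>I. real D * f i \<in> \<int>" by auto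
  have "f i \<in> \<rat>" using insert by simp
  then obtain a b :: int where ab: "b > 0" "f i = real_of_int a / real_of_int b"
    by (rule Rats_cases') 
  have "real (D * nat b) * f i = real_of_int (int D * a)"
    using ab by simp
  moreover have "real (D * nat b) * f j \<in> \<int>" if "j \<in> I" for j
  proof -
    have "real (D * nat b) * f j = real_of_int b * (real D * f j)" using ab by simp
    also have "\<dots> \<in> \<int>"
      by (intro Ints_mult Ints_of_int bspec[OF D(2) that])
    finally show ?thesis .
  qed
  ultimately show ?case
    using D ab by (intro exI[of _ "D * nat b"]) (auto simp del: of_nat_mult)
qed

text \<open>At a high level the densities that \<open>B\<close> needs in each tower are forced by
  the target values. They lie between 0 and the density of \<open>A\<close> because the strict
  inequalities leave a uniform gap, and they are multiples of \<open>1 / height n\<close> by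
  divisibility; so the required number of floors can be picked inside \<open>A\<close>.\<close>

theorem prescribe_val:
  assumes A: "A \<in> clopens tower_space"
    and rat: "\<And>k. f k \<in> \<rat>" and per: "\<And>k. f (k mod 2 ^ N) = f k" and fq: "\<And>k. f (q k) = f k"
    and pos: "\<And>k. 0 < f k" and less: "\<And>k. f k < val A k"
  shows "\<exists>B\<in>clopens tower_space. B \<subseteq> A \<and> (\<forall>k. val B k = f k)"
proof -
  obtain D :: nat where D: "0 < D" "\<And>i. i < 2 ^ N \<Longrightarrow> real D * f i \<in> \<int>"
    using common_denominator[of "{..<2 ^ N}" f] rat by auto
  have DI: "real D * f k \<in> \<int>" for k
    using D(2)[of "k mod 2 ^ N"] per by simp
  obtain N' where N': "has_level A N'" using clopen_has_level[OF A] .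
  define M where "M = max N N'"
  have lM: "has_level A M" using has_level_mono[OF N'] by (simp add: M_def)
  \<comment> \<open>The gap is uniform: \<open>f\<close> and \<open>val A\<close> are periodic
    modulo \<open>2 ^ M\<close>, so a minimum over one period bounds both differences
    everywhere.\<close>
  define \<delta> where "\<delta> = Min ((\<lambda>k. min (f k) (val A k - f k)) ` {..<2 ^ M})"
  have "0 < \<delta>"
    unfolding \<delta>_def using pos less by (subst Min_gr_iff) (auto simp: lessThan_empty_iff)
  have perM: "f (k mod 2 ^ M) = f k" for k
    using per[of "k mod 2 ^ M"] per[of k] by (simp add: M_def mod_mod_cancel le_imp_power_dvd)
  have \<delta>: "\<delta> \<le> f k" "\<delta> \<le> val A k - f k" for k
  proof -
    have "\<delta> \<le> min (f (k mod 2 ^ M)) (val A (k mod 2 ^ M) - f (k mod 2 ^ M))"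
      unfolding \<delta>_def by (intro Min_le) auto
    then show "\<delta> \<le> f k" "\<delta> \<le> val A k - f k"
      using perM val_mod[OF lM] by simp_all
  qed
  obtain n0 :: nat where n0: "1 / \<delta> < real n0" using reals_Archimedean2 by blast
  \<comment> \<open>Three requirements: \<open>n\<close> is a level of \<open>A\<close>, the gap
    beats the averages (\<open>1 \<le> (real n + 2) * \<delta>\<close>), and
    \<open>D \<le> Suc n\<close> for divisibility.\<close>
  define n where "n = max M (max n0 D)"
  have n: "has_level A n" "D \<le> Suc n" "N \<le> n"
    using has_level_mono[OF lM, of n] by (simp_all add: n_def M_def)
  have "1 / \<delta> < real n + 2" using n0 by (simp add: n_def)
  then have n\<delta>: "1 \<le> (real n + 2) * \<delta>"
    using \<open>0 < \<delta>\<close> by (simp add: field_simps)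
  define a where "a = avg n f"
  \<comment> \<open>The formula of \<open>density_eq_val\<close> with \<open>f\<close> in place of
    the value function.\<close>
  define g where "g v = ((real n + 2) * f v - a) / (real n + 1)" for v
  let ?S = "slice n A"
  have fle: "f k \<le> 1" for k using less[of k] val_le_1[OF A, of k] by linarith
  have a1: "0 \<le> a" "a \<le> 1"
    using avg_nonneg[of f n] avg_mono[of f "\<lambda>_. 1" n] fle less_imp_le[OF pos]
    by (simp_all add: a_def avg_const)
  have g0: "0 \<le> g v" for v
  proof -
    have "(real n + 2) * \<delta> \<le> (real n + 2) * f v" using \<delta>(1) by (intro mult_left_mono) simp_all
    then show ?thesis unfolding g_def using n\<delta> a1 by (intro divide_nonneg_pos) linarith+
  qed
  have gle: "g v \<le> density n ?S v" if v: "v \<in> labels n" for v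
  proof -
    have "(real n + 2) * \<delta> \<le> (real n + 2) * (val A v - f v)" using \<delta>(2) by (intro mult_left_mono) simp_all
    then have "1 \<le> (real n + 2) * val A v - (real n + 2) * f v"
      using n\<delta> by (simp add: right_diff_distrib)
    moreover have "avg n (val A) \<le> 1"
      using avg_mono[of "val A" "\<lambda>_. 1" n] val_le_1[OF A] by (simp add: avg_const)
    ultimately have "(real n + 2) * f v - a \<le> (real n + 2) * val A v - avg n (val A)"
      using a1 by linarith
    then show ?thesis unfolding g_def density_eq_val[OF n(1) v] by (intro divide_right_mono) simp_all
  qed
  have "\<exists>b::nat. real b = real (height n) * g v" for v
  proof -
    obtain m where m: "height n = 2 ^ n * (Suc n * D) * m"
      using height_dvd'[OF D(1) n(2)] by (elim dvdE)
    have "real (height n) * g v = real m * (2 ^ n * ((real n + 2) * (real D * f v)) - (2 ^ n * (real D * a)))"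
    proof -
      have ne: "real n + 1 \<noteq> 0" by linarith
      have "real (height n) = 2 ^ n * ((real n + 1) * real D) * real m"
        using arg_cong[OF m, of real] by (simp add: algebra_simps)
      then have "real (height n) * g v = 2 ^ n * real D * real m * ((real n + 1) * g v)"
        by (simp only: mult_ac)
      also have "(real n + 1) * g v = (real n + 2) * f v - a"
        using ne by (simp add: g_def)
      finally show ?thesis by (simp add: algebra_simps)
    qed
    also have "2 ^ n * (real D * a) = real D * (\<Sum>i<2 ^ n. f (q i))"
      by (simp add: a_def avg_def)
    also have "\<dots> = (\<Sum>i<2 ^ n. real D * f (q i))"
      by (rule sum_distrib_left)
    also have "real m * (2 ^ n * ((real n + 2) * (real D * f v)) - (\<Sum>i<2 ^ n. real D * f (q i))) \<in> \<int>"
      by (intro Ints_mult Ints_diff Ints_add Ints_sum DI Ints_power) simp_all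
    finally have "real (height n) * g v \<in> \<int>" .
    moreover have "0 \<le> real (height n) * g v" using g0 by simp
    ultimately have "real (height n) * g v \<in> \<nat>" by (simp add: Nats_altdef2)
    then show ?thesis by (elim Nats_cases) (intro exI, rule sym)
  qed
  then obtain b where b: "\<And>v. real (b v) = real (height n) * g v" by metis
  have "\<exists>J. J \<subseteq> {j. j < height n \<and> (j, v) \<in> ?S} \<and> card J = b v" if v: "v \<in> labels n" for v
  proof -
    have "real (height n) * g v \<le> real (height n) * density n ?S v"
      using gle[OF v] by (intro mult_left_mono) simp_all
    also have "\<dots> = real (card {j. j < height n \<and> (j, v) \<in> ?S})"
      by (simp add: density_def)
    finally have "b v \<le> card {j. j < height n \<and> (j, v) \<in> ?S}" by (simp add: b[symmetric])
    then show ?thesis by (rule obtain_subset_with_card_n) blast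
  qed
  then obtain J where J: "\<And>v. v \<in> labels n \<Longrightarrow> J v \<subseteq> {j. j < height n \<and> (j, v) \<in> ?S}"
    "\<And>v. v \<in> labels n \<Longrightarrow> card (J v) = b v" by metis
  define T where "T = {(j, v). v \<in> labels n \<and> j \<in> J v}"
  have TS: "T \<subseteq> ?S" unfolding T_def using J(1) by blast
  then have Tf: "T \<subseteq> floors n" using slice_subset[OF has_level_subset[OF n(1)], of n] by (rule subset_trans)
  define B where "B = {x \<in> points. x n \<in> T}"
  have lB: "has_level B n" unfolding B_def by (rule has_level_Collect)
  have sB: "slice n B = T" unfolding B_def by (rule slice_Collect[OF Tf])
  have "B \<subseteq> A"
  proof
    fix x assume "x \<in> B"
    then have "x \<in> points" "x n \<in> ?S" unfolding B_def using TS by blast+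
    then show "x \<in> A" using has_level_mem_iff[OF n(1)] by simp
  qed
  have dT: "density n T v = g v" if v: "v \<in> labels n" for v
  proof -
    have "{j. j < height n \<and> (j, v) \<in> T} = J v"
      using J(1)[OF v] v unfolding T_def by blast
    then show ?thesis using J(2)[OF v] b[of v] by (simp add: density_def)
  qed
  \<comment> \<open>The chosen densities must average to \<open>a\<close> again; only then does
    \<open>level_value\<close> of \<open>T\<close> return \<open>f\<close>.\<close>
  have "avg n (density n T) = avg n g" by (rule avg_cong) (rule dT)
  also have "\<dots> = avg n (\<lambda>v. (real n + 2) / (real n + 1) * f v + - a / (real n + 1))"
    by (rule avg_cong) (simp add: g_def diff_divide_distrib)
  also have "\<dots> = (real n + 2) / (real n + 1) * a + - a / (real n + 1)"
    by (simp only: avg_add avg_cmult avg_const a_def)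
  also have "\<dots> = a"
  proof -
    have "(M + 1) / M * a + - a / M = a" if "M \<noteq> 0" for M :: real
      using that by (simp add: field_simps)
    from this[of "real n + 1"] show ?thesis by (simp add: add.commute)
  qed
  finally have aT: "avg n (density n T) = a" .
  have "val B k = f k" for k
  proof -
    have l: "q k mod 2 ^ n \<in> labels n" by (intro mod_mem_labels) simp
    have fk: "f (q k mod 2 ^ n) = f k"
    proof -
      have "f (q k mod 2 ^ n) = f (q k mod 2 ^ n mod 2 ^ N)" by (simp only: per)
      also have "\<dots> = f (q k mod 2 ^ N)" using n(3) by (simp add: mod_mod_cancel le_imp_power_dvd)
      finally show ?thesis by (simp add: per fq)
    qed
    have "val B k = ((real n + 1) * g (q k mod 2 ^ n) + a) / (real n + 2)"
      unfolding val_eq[OF lB] sB level_value_def aT dT[OF l] ..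
    also have "(real n + 1) * g (q k mod 2 ^ n) = (real n + 2) * f k - a"
      unfolding g_def fk by (simp add: field_simps)
    finally have e: "val B k = (real n + 2) * f k / (real n + 2)" by (simp only: diff_add_cancel)
    have "real n + 2 \<noteq> 0" by linarith
    then show ?thesis unfolding e by (rule nonzero_mult_div_cancel_left)
  qed
  then show ?thesis
    using has_level_clopen[OF lB] \<open>B \<subseteq> A\<close> by (intro bexI[of _ B] conjI allI)
qed

subsection \<open>Invariant measures\<close>

text \<open>On level \<open>n + 1\<close> the preimage arises by rotating each tower cyclically by
  one floor, which keeps the number of floors in it.\<close>

lemma val_step_vimage:
  assumes A: "A \<in> clopens tower_space"
  shows "val {x \<in> points. step x \<in> A} k = val A k"
proof -
  obtain n where n: "has_level A n" using clopen_has_level[OF A] .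
  let ?H = "height (Suc n)"
  let ?T = "{z \<in> floors (Suc n). proj n z \<in> slice n A}"
  let ?T' = "{z \<in> floors (Suc n). succ_pos (Suc n) z \<in> ?T}"
  have "step x \<in> A \<longleftrightarrow> x (Suc n) \<in> ?T'" if x: "x \<in> points" for x
  proof -
    have "step x \<in> A \<longleftrightarrow> step x n \<in> slice n A"
      using has_level_mem_iff[OF n step_mem[OF x]] by simp
    then show ?thesis
      using pointsD(1)[OF x] succ_pos_mem_floors[OF pointsD(1)[OF x]] by (simp add: step_def)
  qed
  then have eq: "{x \<in> points. step x \<in> A} = {x \<in> points. x (Suc n) \<in> ?T'}" by blast
  have lB: "has_level {x \<in> points. step x \<in> A} (Suc n)"
    unfolding eq by (rule has_level_Collect)
  have sB: "slice (Suc n) {x \<in> points. step x \<in> A} = ?T'"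
    unfolding eq by (rule slice_Collect) blast
  have lA: "has_level A (Suc n)" using has_level_mono[OF n] by simp
  have "density (Suc n) ?T' w = density (Suc n) ?T w" for w
  proof -
    let ?f = "\<lambda>j. fst (succ_pos (Suc n) (j, w))" and ?g = "\<lambda>j. fst (pred_pos (Suc n) (j, w))"
    have sp: "succ_pos (Suc n) (j, w) = (?f j, w)" "pred_pos (Suc n) (j, w) = (?g j, w)"
      "?f j < ?H" "?g j < ?H" for j
      by (simp_all add: succ_pos_def pred_pos_def del: height.simps)
    have inv: "?f (?g j) = j" "?g (?f j) = j" if "j < ?H" for j
      using succ_pred_pos[of "(j, w)" "Suc n"] pred_succ_pos[of "(j, w)" "Suc n"] that sp(1,2)
      by (simp_all del: height.simps)
    have "bij_betw ?f {j. j < ?H \<and> (j, w) \<in> ?T'} {j. j < ?H \<and> (j, w) \<in> ?T}"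
    proof (rule bij_betw_byWitness[where f' = ?g])
      show "\<forall>j\<in>{j. j < ?H \<and> (j, w) \<in> ?T'}. ?g (?f j) = j" using inv(2) by blast
      show "\<forall>j\<in>{j. j < ?H \<and> (j, w) \<in> ?T}. ?f (?g j) = j" using inv(1) by blast
      show "?f ` {j. j < ?H \<and> (j, w) \<in> ?T'} \<subseteq> {j. j < ?H \<and> (j, w) \<in> ?T}"
        using sp by auto
      show "?g ` {j. j < ?H \<and> (j, w) \<in> ?T} \<subseteq> {j. j < ?H \<and> (j, w) \<in> ?T'}"
      proof
        fix i assume "i \<in> ?g ` {j. j < ?H \<and> (j, w) \<in> ?T}"
        then obtain j where j: "i = ?g j" "j < ?H" "(j, w) \<in> ?T" by blast
        have "(?g j, w) \<in> floors (Suc n)"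
          using pred_pos_mem_floors[of "(j, w)" "Suc n"] j(3) sp(2)[of j] by simp
        moreover have "succ_pos (Suc n) (?g j, w) = (j, w)"
          using succ_pred_pos[of "(j, w)" "Suc n"] j(2) sp(2)[of j] by simp
        ultimately show "i \<in> {j. j < ?H \<and> (j, w) \<in> ?T'}"
          using j sp(4)[of j] by simp
      qed
    qed
    then show ?thesis by (simp only: density_def bij_betw_same_card)
  qed
  then have "density (Suc n) ?T' = density (Suc n) ?T" by (rule ext)
  then show ?thesis
    unfolding val_eq[OF lB] val_eq[OF lA] sB slice_Suc[OF n] level_value_def by (simp only:)
qed

abbreviation tower_simplex where "tower_simplex \<equiv> invariant_measures tower_space step"

lemma continuous_step: "continuous_map tower_space tower_space step"
  using step_homeomorphic by (simp add: homeomorphic_maps_def)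

lemma simplex_prob: "\<mu> \<in> tower_simplex \<Longrightarrow> \<mu> \<in> borel_prob_measures tower_space"
  by (simp add: invariant_measures_def)

lemma simplex_measure_step:
  assumes "\<mu> \<in> tower_simplex" "A \<in> clopens tower_space"
  shows "measure \<mu> {x \<in> points. step x \<in> A} = measure \<mu> A"
proof -
  have "push tower_space step \<mu> = \<mu>"
    using assms(1) by (simp add: invariant_measures_def pushforward_eq_push)
  then show ?thesis
    using measure_push[OF continuous_step simplex_prob[OF assms(1)] clopens_in_borel[OF assms(2)]] by simp
qed

lemma simplexI:
  assumes "\<mu> \<in> borel_prob_measures tower_space"
    and "\<And>A. A \<in> clopens tower_space \<Longrightarrow> measure \<mu> {x \<in> points. step x \<in> A} = measure \<mu> A"
  shows "\<mu> \<in> tower_simplex"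
proof -
  have "push tower_space step \<mu> = \<mu>"
  proof (rule borel_measure_eqI[OF stone_space_tower_space push_borel_prob[OF continuous_step assms(1)] assms(1)])
    fix A assume A: "A \<in> clopens tower_space"
    show "measure (push tower_space step \<mu>) A = measure \<mu> A"
      using measure_push[OF continuous_step assms(1) clopens_in_borel[OF A]] assms(2)[OF A] by simp
  qed
  then show ?thesis using assms(1) by (simp add: invariant_measures_def pushforward_eq_push)
qed

text \<open>For an invariant measure all floors of a tower have equal mass, so this is the mass of
  the whole tower \<open>v\<close>.\<close>

definition tower_mass :: "(nat \<Rightarrow> nat \<times> nat) measure \<Rightarrow> nat \<Rightarrow> nat \<Rightarrow> real" where
  "tower_mass \<mu> n v = real (height n) * measure \<mu> {x \<in> points. x n \<in> {(0, v)}}"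

lemma tower_mass_nonneg: "0 \<le> tower_mass \<mu> n v"
  by (simp add: tower_mass_def)

lemma measure_floor:
  assumes \<mu>: "\<mu> \<in> tower_simplex" and j: "j < height n"
  shows "measure \<mu> {x \<in> points. x n \<in> {(j, v)}} = measure \<mu> {x \<in> points. x n \<in> {(0, v)}}"
  using j
proof (induction j)
  case (Suc j)
  have "step x n = (Suc j, v) \<longleftrightarrow> x n = (j, v)" if x: "x \<in> points" for x
  proof
    assume "x n = (j, v)"
    then show "step x n = (Suc j, v)" using step_same_tower[OF x, of n] Suc.prems by simp
  next
    assume "step x n = (Suc j, v)"
    then show "x n = (j, v)"
      using unstep_same_tower[OF step_mem[OF x], of n] unstep_step[OF x] by simp
  qed
  then have "{x \<in> points. step x \<in> {x \<in> points. x n \<in> {(Suc j, v)}}} = {x \<in> points. x n \<in> {(j, v)}}"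
    using step_mem by auto
  then show ?case
    using simplex_measure_step[OF \<mu> seq_top_coordinate[of points n "{(Suc j, v)}"]] Suc by simp
qed simp

lemma measure_eq_tower_mass:
  assumes \<mu>: "\<mu> \<in> tower_simplex" and A: "has_level A n"
  shows "measure \<mu> A = (\<Sum>v\<in>labels n. tower_mass \<mu> n v * density n (slice n A) v)"
proof -
  interpret prob_space \<mu> using borel_prob_measuresD(1)[OF simplex_prob[OF \<mu>]] .
  let ?S = "slice n A"
  let ?F = "\<lambda>z. {x \<in> points. x n \<in> {z}}"
  let ?m = "\<lambda>v. measure \<mu> {x \<in> points. x n \<in> {(0, v)}}"
  have Sf: "?S \<subseteq> floors n" by (rule slice_subset[OF has_level_subset[OF A]])
  have fin: "finite ?S" using Sf finite_floors by (rule finite_subset)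
  have "A = (\<Union>z\<in>?S. ?F z)"
    by (subst has_level_eq[OF A]) blast
  then have "measure \<mu> A = measure \<mu> (\<Union>z\<in>?S. ?F z)" by (rule arg_cong)
  also have "\<dots> = (\<Sum>z\<in>?S. measure \<mu> (?F z))"
  proof (rule finite_measure_finite_Union[OF fin])
    have "?F z \<in> sets \<mu>" for z
      unfolding borel_prob_measuresD(2)[OF simplex_prob[OF \<mu>]]
      by (rule clopens_in_borel[OF seq_top_coordinate])
    then show "?F ` ?S \<subseteq> sets \<mu>" by blast
    show "disjoint_family_on ?F ?S" unfolding disjoint_family_on_def by auto
  qed
  also have "\<dots> = (\<Sum>z\<in>?S. ?m (snd z))"
  proof (rule sum.cong)
    fix z assume "z \<in> ?S"
    then have "fst z < height n" using Sf floorsD(1) by blast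
    then show "measure \<mu> (?F z) = ?m (snd z)" using measure_floor[OF \<mu>, of "fst z" n "snd z"] by simp
  qed simp
  also have "\<dots> = (\<Sum>z\<in>floors n. (if z \<in> ?S then 1 else 0) * ?m (snd z))"
    by (rule sum.mono_neutral_cong_left) (use Sf in auto)
  also have "\<dots> = (\<Sum>j<height n. \<Sum>v\<in>labels n. (if (j, v) \<in> ?S then 1 else 0) * ?m v)"
    unfolding floors_def by (subst sum.cartesian_product) (simp only: case_prod_unfold prod.collapse)
  also have "\<dots> = (\<Sum>v\<in>labels n. \<Sum>j<height n. (if (j, v) \<in> ?S then 1 else 0) * ?m v)"
    by (rule sum.swap)
  also have "\<dots> = (\<Sum>v\<in>labels n. density n ?S v * height n * ?m v)"
    by (simp only: density_sum sum_distrib_right)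
  also have "\<dots> = (\<Sum>v\<in>labels n. tower_mass \<mu> n v * density n ?S v)"
    by (intro sum.cong) (simp_all add: tower_mass_def)
  finally show ?thesis .
qed

lemma sum_tower_mass:
  assumes "\<mu> \<in> tower_simplex"
  shows "(\<Sum>v\<in>labels n. tower_mass \<mu> n v) = 1"
proof -
  have l: "has_level points n" by (simp add: has_level_def)
  have d: "density n (floors n) v = 1" if "v \<in> labels n" for v
    using that by (simp add: density_def floors_def)
  have "measure \<mu> points = 1"
    using prob_space.prob_space[OF borel_prob_measuresD(1)[OF simplex_prob[OF assms]]]
      borel_prob_measuresD(3)[OF simplex_prob[OF assms]] by simp
  then show ?thesis
    using measure_eq_tower_mass[OF assms l] d by (simp add: slice_points)
qed

text \<open>At a common level equal values force equal densities in all towers, and an invariant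
  measure sees only these.\<close>

lemma simplex_measure_cong:
  assumes \<mu>: "\<mu> \<in> tower_simplex" and A: "A \<in> clopens tower_space" and B: "B \<in> clopens tower_space"
    and e: "\<And>k. val A k = val B k"
  shows "measure \<mu> A = measure \<mu> B"
proof -
  obtain n where n: "has_level A n" "has_level B n" using common_level[OF A B] by metis
  have "val A = val B" by (rule ext) (rule e)
  have "density n (slice n A) v = density n (slice n B) v" if "v \<in> labels n" for v
    unfolding density_eq_val[OF n(1) that] density_eq_val[OF n(2) that] \<open>val A = val B\<close> ..
  then show ?thesis
    unfolding measure_eq_tower_mass[OF \<mu> n(1)] measure_eq_tower_mass[OF \<mu> n(2)]
    by (intro sum.cong arg_cong2[where f = times]) simp_all
qed

lemma simplexI_val:
  assumes \<mu>: "\<mu> \<in> borel_prob_measures tower_space"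
    and cong: "\<And>A B. A \<in> clopens tower_space \<Longrightarrow> B \<in> clopens tower_space \<Longrightarrow>
      (\<And>k. val A k = val B k) \<Longrightarrow> measure \<mu> A = measure \<mu> B"
  shows "\<mu> \<in> tower_simplex"
proof (rule simplexI[OF \<mu>])
  fix A assume A: "A \<in> clopens tower_space"
  have B: "{x \<in> points. step x \<in> A} \<in> clopens tower_space"
    using clopens_vimage[OF continuous_step A] by simp
  show "measure \<mu> {x \<in> points. step x \<in> A} = measure \<mu> A"
    by (rule cong[OF B A]) (rule val_step_vimage[OF A])
qed

lemma val_state:
  obtains \<mu> where "\<mu> \<in> tower_simplex" "\<And>A. A \<in> clopens tower_space \<Longrightarrow> measure \<mu> A = val A k"
proof (rule borel_measure_extension[OF stone_space_tower_space, of "\<lambda>A. val A k"])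
  show "val (topspace tower_space) k = 1" by (simp add: val_points)
  fix \<mu> assume \<mu>: "\<mu> \<in> borel_prob_measures tower_space"
    "\<And>A. A \<in> clopens tower_space \<Longrightarrow> measure \<mu> A = val A k"
  have "\<mu> \<in> tower_simplex" by (rule simplexI_val[OF \<mu>(1)]) (simp only: \<mu>(2))
  then show thesis using \<mu>(2) by (rule that)
qed (rule val_nonneg val_Un; assumption)+

text \<open>Up to an error tending to 0, every invariant measure is a convex combination of
  evaluations at labels. This replaces an integral representation over the parameter space.\<close>

lemma measure_close:
  assumes \<mu>: "\<mu> \<in> tower_simplex" and A: "has_level A n"
  shows "\<bar>measure \<mu> A - (\<Sum>v\<in>labels n. tower_mass \<mu> n v * val A v)\<bar> \<le> 1 / (real n + 1)"
proof -
  have "\<bar>measure \<mu> A - (\<Sum>v\<in>labels n. tower_mass \<mu> n v * val A v)\<bar> =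
      \<bar>\<Sum>v\<in>labels n. tower_mass \<mu> n v * (density n (slice n A) v - val A v)\<bar>"
    unfolding measure_eq_tower_mass[OF \<mu> A] by (simp add: sum_subtractf[symmetric] right_diff_distrib)
  also have "\<dots> \<le> (\<Sum>v\<in>labels n. \<bar>tower_mass \<mu> n v * (density n (slice n A) v - val A v)\<bar>)"
    by (rule sum_abs)
  also have "\<dots> \<le> (\<Sum>v\<in>labels n. tower_mass \<mu> n v * (1 / (real n + 1)))"
    unfolding abs_mult abs_of_nonneg[OF tower_mass_nonneg]
    using density_val_close[OF A] tower_mass_nonneg by (intro sum_mono mult_left_mono)
  also have "\<dots> = 1 / (real n + 1)"
    by (simp only: sum_distrib_right[symmetric] sum_tower_mass[OF \<mu>] mult_1)
  finally show ?thesis .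
qed

lemma measure_le_val:
  assumes \<mu>: "\<mu> \<in> tower_simplex" and A: "A \<in> clopens tower_space" and le: "\<And>v. val A v \<le> c"
  shows "measure \<mu> A \<le> c"
proof -
  obtain m where m: "has_level A m" using clopen_has_level[OF A] .
  show ?thesis
  proof (rule le_if_le_inverse_Suc[where c = 1])
    fix n assume "m \<le> n"
    then have n: "has_level A n" using has_level_mono[OF m] by simp
    have "(\<Sum>v\<in>labels n. tower_mass \<mu> n v * val A v) \<le> (\<Sum>v\<in>labels n. tower_mass \<mu> n v * c)"
      using le tower_mass_nonneg by (intro sum_mono mult_left_mono)
    also have "\<dots> = c" by (simp only: sum_distrib_right[symmetric] sum_tower_mass[OF \<mu>] mult_1)
    finally show "measure \<mu> A \<le> c + 1 / (real n + 1)"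
      using measure_close[OF \<mu> n] by linarith
  qed
qed

end


section \<open>Embeddings between tower systems\<close>

text \<open>The map \<open>s\<close> stands for a continuous embedding of the first parameter space
  into the second, and \<open>r\<close> for a left inverse that may lose one binary digit. The
  relation says that the value function of \<open>A\<close> is that of \<open>B\<close> composed
  with \<open>s\<close>. In one direction functions are restricted along \<open>s\<close>; in the
  other they are extended with the help of \<open>r\<close>. Preimages under the resulting map
  compose value functions with \<open>s\<close>, so equality of values is preserved and invariant
  measures go to invariant ones.\<close>

theorem tower_simplex_embedding:
  fixes q p s r :: "nat \<Rightarrow> nat"
  assumes q: "label_retraction q" and p: "label_retraction p"
    and s_mod: "\<And>k n. s (k mod 2 ^ n) mod 2 ^ n = s k mod 2 ^ n"
    and r_mod: "\<And>j n. r (j mod 2 ^ Suc n) mod 2 ^ n = r j mod 2 ^ n"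
    and sq: "\<And>k. s (q k) = s k" and rs: "\<And>k. q (r (p (s k))) = q k"
  obtains g where
    "homeomorphic_map (label_retraction.tower_space q) (label_retraction.tower_space p) g"
    "push (label_retraction.tower_space p) g ` label_retraction.tower_simplex q
      \<subseteq> label_retraction.tower_simplex p"
proof -
  interpret Q: label_retraction q by (rule q)
  interpret P: label_retraction p by (rule p)
  let ?R = "\<lambda>A B. \<forall>k. Q.val A k = P.val B (s k)"
  have "\<exists>g. homeomorphic_map Q.tower_space P.tower_space g \<and> (\<forall>A\<in>clopens Q.tower_space. ?R A (g ` A))"
  proof (rule stone_back_and_forth[OF Q.stone_space_tower_space P.stone_space_tower_space])
    show "?R (topspace Q.tower_space) (topspace P.tower_space)"
      by (simp add: Q.val_points P.val_points)
  next
    fix A B assume A: "A \<in> clopens Q.tower_space" and B: "B \<in> clopens P.tower_space" and R: "?R A B"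
    show "A = {} \<longleftrightarrow> B = {}"
    proof (rule ccontr)
      assume "\<not> (A = {} \<longleftrightarrow> B = {})"
      then consider "A = {}" "B \<noteq> {}" | "A \<noteq> {}" "B = {}" by blast
      then show False
      proof cases
        case 1
        then show False using P.val_pos[OF B, of "s 0"] spec[OF R, of 0] by simp
      next
        case 2
        then show False using Q.val_pos[OF A, of 0] spec[OF R, of 0] by simp
      qed
    qed
  next
    fix A B C D assume A: "A \<in> clopens Q.tower_space" and B: "B \<in> clopens P.tower_space"
      and C: "C \<in> clopens Q.tower_space" and D: "D \<in> clopens P.tower_space"
      and "?R A B" "?R C D" "A \<inter> C = {}" "B \<inter> D = {}"
    then show "?R (A \<union> C) (B \<union> D)"
      using Q.val_Un[OF A C] P.val_Un[OF B D] by simp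
  next
    fix A B C assume A: "A \<in> clopens Q.tower_space" and B: "B \<in> clopens P.tower_space"
      and R: "?R A B" and C: "C \<in> clopens Q.tower_space" "C \<subseteq> A"
    have "\<exists>D\<in>clopens P.tower_space. D \<subseteq> B \<and> ?R C D"
    proof -
      consider "C = {}" | "C = A" | "C \<noteq> {}" "A - C \<noteq> {}" using C(2) by blast
      then show ?thesis
      proof cases
        case 1
        then show ?thesis by (intro bexI[of _ "{}"]) simp_all
      next
        case 2
        then show ?thesis using R B by (intro bexI[of _ B]) simp_all
      next
        case 3
        have CA: "Q.val C k < Q.val A k" for k
          using Q.val_pos[OF clopens_Diff[OF A C(1)] 3(2), of k] Q.val_Diff[OF A C(1) C(2), of k] by simp
        have C0: "0 < Q.val C k" for k using Q.val_pos[OF C(1) 3(1)] .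
        have B0: "0 < P.val B j" for j
        proof (rule P.val_pos[OF B])
          show "B \<noteq> {}"
            using spec[OF R, of 0] CA[of 0] C0[of 0] by auto
        qed
        \<comment> \<open>Composition with \<open>r\<close> extends the value function of
          \<open>C\<close> beyond the image of \<open>s\<close>, but it may fail to stay below that
          of \<open>B\<close>; there half of \<open>P.val B\<close> is taken. At the parameters
          \<open>p (s k)\<close> the first case applies, as \<open>C\<close> has smaller values than
          \<open>A\<close>.\<close>
        define g where "g j = (if Q.val C (r j) < P.val B j then Q.val C (r j) else P.val B j / 2)" for j
        obtain a b where ab: "Q.has_level C a" "P.has_level B b"
          using Q.clopen_has_level[OF C(1)] P.clopen_has_level[OF B] by metis
        let ?n = "max a b"
        \<comment> \<open>One more digit is kept on the side of \<open>B\<close>, because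
          \<open>r\<close> modulo \<open>2 ^ n\<close> is determined only modulo
          \<open>2 ^ Suc n\<close>.\<close>
        have lC: "Q.has_level C ?n" and lB: "P.has_level B (Suc ?n)"
          using Q.has_level_mono[OF ab(1), of ?n] P.has_level_mono[OF ab(2), of "Suc ?n"] by simp_all
        have Cr: "Q.val C (r (j mod 2 ^ Suc ?n)) = Q.val C (r j)" for j
          using Q.val_mod[OF lC, of "r (j mod 2 ^ Suc ?n)"] Q.val_mod[OF lC, of "r j"] r_mod[of j ?n] by simp
        have gmod: "g (j mod 2 ^ Suc ?n) = g j" for j
          unfolding g_def Cr P.val_mod[OF lB] ..
        have "\<exists>D\<in>clopens P.tower_space. D \<subseteq> B \<and> (\<forall>j. P.val D j = g (p j))"
        proof (rule P.prescribe_val[OF B, of "\<lambda>j. g (p j)" "Suc ?n"])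
          fix j
          show "g (p j) \<in> \<rat>"
            unfolding g_def using Q.val_Rats[OF C(1)] P.val_Rats[OF B] by simp
          show "g (p (j mod 2 ^ Suc ?n)) = g (p j)"
            unfolding P.mod_compat[symmetric] by (rule gmod)
          show "g (p (p j)) = g (p j)" by simp
          show "0 < g (p j)" unfolding g_def using C0 B0 by simp
          have "g (p j) < P.val B (p j)" unfolding g_def using B0[of "p j"] by simp
          then show "g (p j) < P.val B j" by (simp only: P.val_q)
        qed
        then obtain D where D: "D \<in> clopens P.tower_space" "D \<subseteq> B" "\<And>j. P.val D j = g (p j)"
          by metis
        have "Q.val C k = P.val D (s k)" for k
        proof -
          have "Q.val C (r (p (s k))) = Q.val C k"
            using Q.val_q[of C "r (p (s k))"] Q.val_q[of C k] rs[of k] by simp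
          moreover have "Q.val C k < P.val B (p (s k))"
            using CA[of k] spec[OF R, of k] by (simp only: P.val_q)
          ultimately show ?thesis unfolding D(3) g_def by simp
        qed
        then show ?thesis using D(1,2) by (intro bexI[of _ D]) simp_all
      qed
    qed
    then obtain D where D: "D \<in> clopens P.tower_space" "D \<subseteq> B" "?R C D" by (elim bexE conjE)
    have "?R (A - C) (B - D)"
      using R D(3) Q.val_Diff[OF A C] P.val_Diff[OF B D(1,2)] by simp
    then show "\<exists>D\<in>clopens P.tower_space. D \<subseteq> B \<and> ?R C D \<and> ?R (A - C) (B - D)"
      using D by (intro bexI[of _ D] conjI)
  next
    fix A B D assume A: "A \<in> clopens Q.tower_space" and B: "B \<in> clopens P.tower_space"
      and R: "?R A B" and D: "D \<in> clopens P.tower_space" "D \<subseteq> B"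
    have "\<exists>C\<in>clopens Q.tower_space. C \<subseteq> A \<and> ?R C D"
    proof -
      consider "D = {}" | "D = B" | "D \<noteq> {}" "B - D \<noteq> {}" using D(2) by blast
      then show ?thesis
      proof cases
        case 1
        then show ?thesis by (intro bexI[of _ "{}"]) simp_all
      next
        case 2
        then show ?thesis using R A by (intro bexI[of _ A]) simp_all
      next
        case 3
        obtain n where n: "P.has_level D n" using P.clopen_has_level[OF D(1)] .
        have "\<exists>C\<in>clopens Q.tower_space. C \<subseteq> A \<and> (\<forall>k. Q.val C k = P.val D (s k))"
        proof (rule Q.prescribe_val[OF A, of "\<lambda>k. P.val D (s k)" n])
          fix k
          show "P.val D (s k) \<in> \<rat>" by (rule P.val_Rats[OF D(1)])
          show "P.val D (s (k mod 2 ^ n)) = P.val D (s k)"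
            using P.val_mod[OF n, of "s (k mod 2 ^ n)"] P.val_mod[OF n, of "s k"] s_mod[of k n] by simp
          show "P.val D (s (q k)) = P.val D (s k)" by (simp only: sq)
          show "0 < P.val D (s k)" by (rule P.val_pos[OF D(1) 3(1)])
          show "P.val D (s k) < Q.val A k"
            using P.val_pos[OF clopens_Diff[OF B D(1)] 3(2), of "s k"] P.val_Diff[OF B D, of "s k"]
              spec[OF R, of k] by simp
        qed
        then show ?thesis .
      qed
    qed
    then obtain C where C: "C \<in> clopens Q.tower_space" "C \<subseteq> A" "?R C D" by (elim bexE conjE)
    have "?R (A - C) (B - D)"
      using R C(3) Q.val_Diff[OF A C(1,2)] P.val_Diff[OF B D] by simp
    then show "\<exists>C\<in>clopens Q.tower_space. C \<subseteq> A \<and> ?R C D \<and> ?R (A - C) (B - D)"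
      using C by (intro bexI[of _ C] conjI)
  qed
  then obtain g where g: "homeomorphic_map Q.tower_space P.tower_space g"
    and R: "\<And>A. A \<in> clopens Q.tower_space \<Longrightarrow> ?R A (g ` A)" by blast
  have cg: "continuous_map Q.tower_space P.tower_space g"
    using homeomorphic_imp_continuous_map[OF g] .
  have "push P.tower_space g \<mu> \<in> P.tower_simplex" if \<mu>: "\<mu> \<in> Q.tower_simplex" for \<mu>
  proof (rule P.simplexI_val)
    have \<mu>': "\<mu> \<in> borel_prob_measures Q.tower_space" by (rule Q.simplex_prob[OF \<mu>])
    then show "push P.tower_space g \<mu> \<in> borel_prob_measures P.tower_space"
      by (rule push_borel_prob[OF cg])
    fix A B assume A: "A \<in> clopens P.tower_space" and B: "B \<in> clopens P.tower_space"
      and e: "\<And>k. P.val A k = P.val B k"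
    let ?pre = "\<lambda>A. {x \<in> topspace Q.tower_space. g x \<in> A}"
    have pre: "?pre A \<in> clopens Q.tower_space \<and> Q.val (?pre A) k = P.val A (s k)"
      if A: "A \<in> clopens P.tower_space" for A k
    proof -
      have c: "?pre A \<in> clopens Q.tower_space" by (rule clopens_vimage[OF cg A])
      have "g ` ?pre A = A"
        using homeomorphic_imp_surjective_map[OF g] clopens_subset[OF A] by auto
      then show ?thesis using spec[OF R[OF c], of k] c by simp
    qed
    have "measure \<mu> (?pre A) = measure \<mu> (?pre B)"
      using pre[OF A] pre[OF B] e by (intro Q.simplex_measure_cong[OF \<mu>]) simp_all
    then show "measure (push P.tower_space g \<mu>) A = measure (push P.tower_space g \<mu>) B"
      by (simp only: measure_push[OF cg \<mu>' clopens_in_borel[OF A]] measure_push[OF cg \<mu>' clopens_in_borel[OF B]])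
  qed
  then show ?thesis using g that by blast
qed

section \<open>The two simplices\<close>

text \<open>All even numbers collapse to 0, so among the fixed points 0 is the only even one and
  hence isolated in the 2-adic topology.\<close>

definition odd_part :: "nat \<Rightarrow> nat" where
  "odd_part i = (if odd i then i else 0)"

lemma odd_part_mod: "odd_part i mod 2 ^ n = odd_part (i mod 2 ^ n)"
proof (cases n)
  case (Suc m)
  have "odd (i mod 2 ^ n) = odd i" unfolding Suc by (simp add: dvd_mod_iff)
  then show ?thesis by (simp add: odd_part_def)
qed (simp add: odd_part_def)

interpretation Id: label_retraction id
  by unfold_locales simp_all

interpretation Od: label_retraction odd_part
  by unfold_locales (simp_all add: odd_part_mod, simp add: odd_part_def)

text \<open>A maximum of the periodic function \<open>val A\<close> at \<open>k\<close> recurs at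
  \<open>k + 2 ^ n\<close>. Both evaluations give \<open>A\<close> the largest possible mass, so a
  strict maximiser would equal both of them, although they are distinct.\<close>

lemma no_strict_maximum_id: "\<not> has_strict_maximum Id.tower_space Id.tower_simplex"
proof
  assume "has_strict_maximum Id.tower_space Id.tower_simplex"
  then obtain A \<nu> where A: "A \<in> clopens Id.tower_space" and \<nu>: "\<nu> \<in> Id.tower_simplex"
    and max: "\<And>\<mu>. \<mu> \<in> Id.tower_simplex \<Longrightarrow> \<mu> \<noteq> \<nu> \<Longrightarrow> measure \<mu> A < measure \<nu> A"
    unfolding has_strict_maximum_def by blast
  obtain n where n: "Id.has_level A n" using Id.clopen_has_level[OF A] .
  let ?M = "Max (Id.val A ` {..<2 ^ n})"
  have "?M \<in> Id.val A ` {..<2 ^ n}"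
    by (intro Max_in) (auto simp: lessThan_empty_iff)
  then obtain k where k: "k < 2 ^ n" "?M = Id.val A k" by auto
  have le: "Id.val A v \<le> Id.val A k" for v
  proof -
    have "Id.val A (v mod 2 ^ n) \<le> ?M" by (intro Max_ge) auto
    then show ?thesis using Id.val_mod[OF n] k(2) by simp
  qed
  let ?k' = "k + 2 ^ n"
  have k': "Id.val A ?k' = Id.val A k"
    using Id.val_mod[OF n, of ?k'] k(1) by simp
  obtain \<mu> where \<mu>: "\<mu> \<in> Id.tower_simplex" "\<And>B. B \<in> clopens Id.tower_space \<Longrightarrow> measure \<mu> B = Id.val B k"
    using Id.val_state[of k] by metis
  obtain \<mu>' where \<mu>': "\<mu>' \<in> Id.tower_simplex" "\<And>B. B \<in> clopens Id.tower_space \<Longrightarrow> measure \<mu>' B = Id.val B ?k'"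
    using Id.val_state[of ?k'] by metis
  have "measure \<nu> A \<le> Id.val A k" by (rule Id.measure_le_val[OF \<nu> A le])
  then have "\<mu> = \<nu>" "\<mu>' = \<nu>"
    using max[OF \<mu>(1)] max[OF \<mu>'(1)] \<mu>(2)[OF A] \<mu>'(2)[OF A] k' by fastforce+
  then have e: "\<mu> = \<mu>'" by simp
  \<comment> \<open>A value function that reads one digit more than the level of \<open>A\<close>
    separates \<open>k\<close> from \<open>k + 2 ^ n\<close>.\<close>
  let ?f = "\<lambda>i. if i mod 2 ^ Suc n = k then 1 / 2 else 1 / 3 :: real"
  have top: "Id.points \<in> clopens Id.tower_space" using clopens_topspace[of Id.tower_space] by simp
  have "\<exists>B\<in>clopens Id.tower_space. B \<subseteq> Id.points \<and> (\<forall>i. Id.val B i = ?f i)"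
    by (rule Id.prescribe_val[OF top, of ?f "Suc n"]) (simp_all add: Id.val_points split: if_splits)
  then obtain B where B: "B \<in> clopens Id.tower_space" "\<And>i. Id.val B i = ?f i" by metis
  have "?f k = ?f ?k'" using \<mu>(2)[OF B(1)] \<mu>'(2)[OF B(1)] e unfolding B(2) by simp
  moreover have "k mod 2 ^ Suc n = k" "?k' mod 2 ^ Suc n = ?k'" using k(1) by simp_all
  ultimately show False by simp
qed

text \<open>The set \<open>A\<close> has value 3/4 at the isolated parameter 0 and 1/4 at the
  others. An invariant measure giving it at least 3/4 has its mass in tower 0 of level
  \<open>n\<close> tending to 1, hence is the evaluation at 0.\<close>

lemma strict_maximum_odd_part: "has_strict_maximum Od.tower_space Od.tower_simplex"
proof -
  let ?f = "\<lambda>i. if odd i then 1 / 4 else 3 / 4 :: real"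
  have top: "Od.points \<in> clopens Od.tower_space" using clopens_topspace[of Od.tower_space] by simp
  have "\<exists>A\<in>clopens Od.tower_space. A \<subseteq> Od.points \<and> (\<forall>i. Od.val A i = ?f i)"
    by (rule Od.prescribe_val[OF top, of ?f 1])
       (simp_all add: Od.val_points odd_part_def mod2_eq_if split: if_splits)
  then obtain A where A: "A \<in> clopens Od.tower_space" "\<And>i. Od.val A i = ?f i" by metis
  obtain \<nu> where \<nu>: "\<nu> \<in> Od.tower_simplex" "\<And>B. B \<in> clopens Od.tower_space \<Longrightarrow> measure \<nu> B = Od.val B 0"
    using Od.val_state[of 0] by metis
  have "measure \<mu> A < measure \<nu> A" if \<mu>: "\<mu> \<in> Od.tower_simplex" "\<mu> \<noteq> \<nu>" for \<mu>
  proof (rule ccontr)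
    assume "\<not> measure \<mu> A < measure \<nu> A"
    then have ge: "3 / 4 \<le> measure \<mu> A" using \<nu>(2)[OF A(1)] A(2)[of 0] by simp
    have "measure \<mu> B = Od.val B 0" if B: "B \<in> clopens Od.tower_space" for B
    proof -
      obtain m where m: "Od.has_level A m" "Od.has_level B m" using Od.common_level[OF A(1) B] by metis
      \<comment> \<open>Of the constant 3, a part 2 bounds the mass outside tower 0 and a part 1 is
        the approximation error for \<open>B\<close>.\<close>
      have "\<bar>measure \<mu> B - Od.val B 0\<bar> \<le> 0 + 3 / (real n + 1)" if "m \<le> n" for n
      proof -
        have n: "Od.has_level A n" "Od.has_level B n"
          using Od.has_level_mono[OF m(1) that] Od.has_level_mono[OF m(2) that] by auto
        let ?w = "Od.tower_mass \<mu> n" and ?V = "Od.labels n"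
        \<comment> \<open>Labels other than 0 are odd, so the value of \<open>A\<close> is 1/4,
          increased by 1/2 at 0.\<close>
        have "(\<Sum>v\<in>?V. ?w v * Od.val A v) = (\<Sum>v\<in>?V. 1 / 4 * ?w v + 1 / 2 * (if v = 0 then ?w v else 0))"
        proof (rule sum.cong)
          fix v assume "v \<in> ?V"
          then have "odd_part v = v" by (simp add: Od.labels_def)
          then have "v = 0 \<or> odd v" by (auto simp: odd_part_def split: if_splits)
          then show "?w v * Od.val A v = 1 / 4 * ?w v + 1 / 2 * (if v = 0 then ?w v else 0)"
            by (elim disjE) (auto simp: A(2))
        qed simp
        also have "\<dots> = 1 / 4 * (\<Sum>v\<in>?V. ?w v) + 1 / 2 * (\<Sum>v\<in>?V. if v = 0 then ?w v else 0)"
          by (simp only: sum.distrib sum_distrib_left)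
        also have "\<dots> = 1 / 4 + 1 / 2 * ?w 0"
          using Od.sum_tower_mass[OF \<mu>(1), of n] by (simp add: sum.delta)
        finally have "3 / 4 \<le> 1 / 4 + 1 / 2 * ?w 0 + 1 / (real n + 1)"
          using ge Od.measure_close[OF \<mu>(1) n(1)] by linarith
        then have w0: "1 - ?w 0 \<le> 2 * (1 / (real n + 1))" by linarith
        have "\<bar>(\<Sum>v\<in>?V. ?w v * Od.val B v) - Od.val B 0\<bar> = \<bar>\<Sum>v\<in>?V. ?w v * (Od.val B v - Od.val B 0)\<bar>"
          using Od.sum_tower_mass[OF \<mu>(1), of n]
          by (simp add: right_diff_distrib sum_subtractf sum_distrib_right[symmetric])
        also have "\<dots> \<le> (\<Sum>v\<in>?V. \<bar>?w v * (Od.val B v - Od.val B 0)\<bar>)" by (rule sum_abs)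
        also have "\<dots> \<le> (\<Sum>v\<in>?V. ?w v - (if v = 0 then ?w v else 0))"
        proof (rule sum_mono)
          fix v
          have "\<bar>Od.val B v - Od.val B 0\<bar> \<le> 1"
            using Od.val_nonneg[OF B, of v] Od.val_le_1[OF B, of v] Od.val_nonneg[OF B, of 0] Od.val_le_1[OF B, of 0]
            by linarith
          then have "?w v * \<bar>Od.val B v - Od.val B 0\<bar> \<le> ?w v * 1"
            by (rule mult_left_mono) (rule Od.tower_mass_nonneg)
          then show "\<bar>?w v * (Od.val B v - Od.val B 0)\<bar> \<le> ?w v - (if v = 0 then ?w v else 0)"
            by (simp add: abs_mult abs_of_nonneg[OF Od.tower_mass_nonneg])
        qed
        also have "\<dots> = 1 - ?w 0"
          using Od.sum_tower_mass[OF \<mu>(1), of n] by (simp add: sum_subtractf sum.delta)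
        finally have "\<bar>(\<Sum>v\<in>?V. ?w v * Od.val B v) - Od.val B 0\<bar> \<le> 2 * (1 / (real n + 1))"
          using w0 by linarith
        then have "\<bar>measure \<mu> B - Od.val B 0\<bar> \<le> 3 * (1 / (real n + 1))"
          using Od.measure_close[OF \<mu>(1) n(2)] by linarith
        then show ?thesis by simp
      qed
      then have "\<bar>measure \<mu> B - Od.val B 0\<bar> \<le> 0" by (rule le_if_le_inverse_Suc)
      then show ?thesis by simp
    qed
    then have "\<mu> = \<nu>"
      using \<nu>(2) by (intro borel_measure_eqI[OF Od.stone_space_tower_space Od.simplex_prob[OF \<mu>(1)] Od.simplex_prob[OF \<nu>(1)]]) simp
    then show False using \<mu>(2) by simp
  qed
  then show ?thesis
    unfolding has_strict_maximum_def using A(1) \<nu>(1) by (intro bexI[of _ A] bexI[of _ \<nu>] ballI impI)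
qed

section \<open>Transfer to the Cantor space\<close>

lemma (in label_retraction) cantor_homeomorphism:
  obtains e d where "homeomorphic_maps tower_space (seq_product :: (nat \<Rightarrow> bool) topology) e d"
proof -
  have "topspace tower_space \<noteq> {}" using points_nonempty by simp
  moreover have "topspace (seq_product :: (nat \<Rightarrow> bool) topology) \<noteq> {}" by simp
  ultimately obtain e where "homeomorphic_map tower_space (seq_product :: (nat \<Rightarrow> bool) topology) e"
    by (rule atomless_stone_homeomorphic[OF stone_space_tower_space stone_space_cantor atomless_tower_space atomless_cantor])
  then show ?thesis using that unfolding homeomorphic_map_maps by blast
qed

lemma push_subset_conjugate:
  assumes e: "homeomorphic_maps X Z e d" and e': "homeomorphic_maps Y Z e' d'"
    and g: "homeomorphic_map X Y g" and K: "K \<subseteq> borel_prob_measures X"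
    and sub: "push Y g ` K \<subseteq> L"
  shows "homeomorphic_map Z Z (e' \<circ> g \<circ> d)"
    and "pushforward Z (e' \<circ> g \<circ> d) ` push Z e ` K \<subseteq> push Z e' ` L"
proof -
  have ce: "continuous_map X Z e" and cd: "continuous_map Z X d" and ce': "continuous_map Y Z e'"
    and cg: "continuous_map X Y g"
    using e e' homeomorphic_imp_continuous_map[OF g] by (simp_all add: homeomorphic_maps_def)
  have "homeomorphic_map Z X d" "homeomorphic_map Y Z e'"
    using homeomorphic_maps_imp_map[OF homeomorphic_maps_sym[THEN iffD1, OF e]] homeomorphic_maps_imp_map[OF e'] .
  then show "homeomorphic_map Z Z (e' \<circ> g \<circ> d)"
    using g by (intro homeomorphic_map_compose[of Z X d Z] homeomorphic_map_compose[of X Y g])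
  have "pushforward Z (e' \<circ> g \<circ> d) (push Z e \<mu>) = push Z e' (push Y g \<mu>)" if "\<mu> \<in> K" for \<mu>
  proof -
    have \<mu>: "\<mu> \<in> borel_prob_measures X" using K that by (rule subsetD)
    have "push Z (e' \<circ> g \<circ> d) (push Z e \<mu>) = push Z (e' \<circ> g) (push X d (push Z e \<mu>))"
      by (rule push_push[OF cd continuous_map_compose[OF cg ce'] push_borel_prob[OF ce \<mu>], symmetric])
    also have "\<dots> = push Z e' (push Y g \<mu>)"
      unfolding push_inverse[OF e \<mu>] by (rule push_push[OF cg ce' \<mu>, symmetric])
    finally show ?thesis by (simp only: pushforward_eq_push)
  qed
  then show "pushforward Z (e' \<circ> g \<circ> d) ` push Z e ` K \<subseteq> push Z e' ` L"
    using sub by auto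
qed

theorem mainTheorem3:
  "\<exists>(X :: (nat \<Rightarrow> bool) topology) K L g h.
     cantor_space X \<and>
     dynamical_simplex X K \<and> dynamical_simplex X L \<and>
     homeomorphic_map X X g \<and> homeomorphic_map X X h \<and>
     pushforward X g ` K \<subseteq> L \<and> pushforward X h ` L \<subseteq> K \<and>
     \<not> (\<exists>f. homeomorphic_map X X f \<and> pushforward X f ` K = L)"
proof -
  let ?Z = "seq_product :: (nat \<Rightarrow> bool) topology"
  obtain e d where e: "homeomorphic_maps Id.tower_space ?Z e d"
    by (rule Id.cantor_homeomorphism)
  obtain e' d' where e': "homeomorphic_maps Od.tower_space ?Z e' d'"
    by (rule Od.cantor_homeomorphism)
  let ?K = "push ?Z e ` Id.tower_simplex" and ?L = "push ?Z e' ` Od.tower_simplex"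
  have Kb: "Id.tower_simplex \<subseteq> borel_prob_measures Id.tower_space"
    and Lb: "Od.tower_simplex \<subseteq> borel_prob_measures Od.tower_space"
    by (rule invariant_measures_subset)+
  have "dynamical_simplex Id.tower_space Id.tower_simplex" "dynamical_simplex Od.tower_space Od.tower_simplex"
    unfolding dynamical_simplex_def using Id.minimal_step Od.minimal_step by blast+
  then have K: "dynamical_simplex ?Z ?K" and L: "dynamical_simplex ?Z ?L"
    using dynamical_simplex_transport[OF e] dynamical_simplex_transport[OF e'] by blast+
  \<comment> \<open>The map \<open>2 * k + 1\<close> embeds all 2-adic integers as the odd ones;
    halving undoes it at the cost of one digit.\<close>
  obtain g where g: "homeomorphic_map Id.tower_space Od.tower_space g"
    "push Od.tower_space g ` Id.tower_simplex \<subseteq> Od.tower_simplex"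
  proof (rule tower_simplex_embedding[OF Id.label_retraction_axioms Od.label_retraction_axioms,
        of "\<lambda>k. 2 * k + 1" "\<lambda>j. j div 2"])
    fix k n :: nat
    show "(2 * (k mod 2 ^ n) + 1) mod 2 ^ n = (2 * k + 1) mod 2 ^ n"
      by (metis mod_add_left_eq mod_mult_right_eq)
    show "(k mod 2 ^ Suc n) div 2 mod 2 ^ n = k div 2 mod 2 ^ n"
      using mod_mult2_eq[of k 2 "2 ^ n"] by simp
    show "id (odd_part (2 * k + 1) div 2) = id k" by (simp add: odd_part_def)
  qed simp_all
  \<comment> \<open>Here the embedding is the inclusion of the smaller parameter space, written as
    \<open>odd_part\<close> so that it is invariant under the retraction.\<close>
  obtain h where h: "homeomorphic_map Od.tower_space Id.tower_space h"
    "push Id.tower_space h ` Od.tower_simplex \<subseteq> Id.tower_simplex"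
  proof (rule tower_simplex_embedding[OF Od.label_retraction_axioms Id.label_retraction_axioms,
        of odd_part id])
    fix k n :: nat
    show "odd_part (k mod 2 ^ n) mod 2 ^ n = odd_part k mod 2 ^ n"
      by (simp add: odd_part_mod)
    show "id (k mod 2 ^ Suc n) mod 2 ^ n = id k mod 2 ^ n"
      by (simp add: mod_mod_cancel)
  qed simp_all
  have "\<not> (\<exists>f. homeomorphic_map ?Z ?Z f \<and> pushforward ?Z f ` ?K = ?L)"
  proof
    assume "\<exists>f. homeomorphic_map ?Z ?Z f \<and> pushforward ?Z f ` ?K = ?L"
    then obtain f f' where f: "homeomorphic_maps ?Z ?Z f f'" "push ?Z f ` ?K = ?L"
      unfolding homeomorphic_map_maps pushforward_eq_push by blast
    \<comment> \<open>Returning \<open>?L\<close> to its tower space lets the strict maximum found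
      there be pulled back along \<open>d'\<close> to \<open>?L\<close>.\<close>
    have inv: "push Od.tower_space d' ` ?L = Od.tower_simplex"
      using push_inverse[OF e'] Lb by (force simp: image_image)
    have "has_strict_maximum ?Z ?L"
      using strict_maximum_odd_part inv dynamical_simplex_subset[OF L]
      by (intro has_strict_maximum_push[OF homeomorphic_maps_sym[THEN iffD1, OF e']]) simp_all
    then have "has_strict_maximum ?Z ?K"
      using has_strict_maximum_push[OF f(1) dynamical_simplex_subset[OF K]] f(2) by simp
    then have "has_strict_maximum Id.tower_space Id.tower_simplex"
      by (rule has_strict_maximum_push[OF e Kb])
    then show False using no_strict_maximum_id by contradiction
  qed
  moreover have "cantor_space ?Z"
    unfolding cantor_space_def by (rule homeomorphic_space_refl)
  ultimately show ?thesis
    using K L push_subset_conjugate[OF e e' g(1) Kb g(2)] push_subset_conjugate[OF e' e h(1) Lb h(2)]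
    by (intro exI[of _ ?Z] exI[of _ ?K] exI[of _ ?L] exI conjI)
qed

end
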